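(* Let $\mathbb{F}_q$ be a finite field with $\operatorname{char}(\mathbb{F}_q)\ne3$ and let $A\in\mathbb{R}$ be fixed. Then $S_A$ has upper density strictly less than $1$, that is, $$\limsup_{T\to\infty}\ \frac{\#\{k\in S_A:\ |k|<q^T\}}{q^T}<1,$$ where $T$ runs over positive integers.
   Context: $\mathcal{O}=\mathbb{F}_q[t]$, $|k|=q^{\deg k}$ for $k\neq 0$, $|0|=0$, $\deg 0=-\infty$. For $A\in\mathbb{R}$, $S_A$ is the set of $k\in\mathcal{O}$ for which there exist $x,y,z\in\mathcal{O}$ with $x^3+y^3+z^3=k$ and $\max\{\deg x,\deg y,\deg z\}\le\frac{\deg k}{3}+A$. *)

theory Defs
  imports
    "HOL-Library.Cardinality"
    "HOL-Library.Extended_Real"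
    "HOL-Library.Liminf_Limsup"
    "HOL-Computational_Algebra.Polynomial"
begin

text \<open>
  The ring \<open>\<F>\<^sub>q[t]\<close> is \<open>'a poly\<close> for a finite field type \<open>'a\<close>, with \<open>q = CARD('a)\<close>.
\<close>

text \<open>The library has \<open>degree 0 = 0\<close>; here the degree of \<open>0\<close> is \<open>-\<infinity>\<close>.\<close>

definition pdeg :: "'a::zero poly \<Rightarrow> ereal" where
  "pdeg p = (if p = 0 then -\<infinity> else ereal (real (degree p)))"

definition pabs :: "'a::{finite,zero} poly \<Rightarrow> real" where
  "pabs p = (if p = 0 then 0 else real CARD('a) ^ degree p)"

text \<open>
  Since \<open>-\<infinity> / 3 + A = -\<infinity>\<close> in \<^typ>\<open>ereal\<close>, for \<open>k = 0\<close> the size condition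
  forces \<open>x = y = z = 0\<close>.
\<close>

definition S :: "real \<Rightarrow> 'a::{finite,field} poly set" where
  "S A = {k. \<exists>x y z. x ^ 3 + y ^ 3 + z ^ 3 = k \<and>
            Max {pdeg x, pdeg y, pdeg z} \<le> pdeg k / 3 + ereal A}"

definition upper_density :: "'a::{finite,field} poly set \<Rightarrow> ereal" where
  "upper_density X =
     limsup (\<lambda>T. ereal (real (card {k \<in> X. pabs k < real CARD('a) ^ T}) / real CARD('a) ^ T))"

end

theory Submission
  imports
    Defs
    "HOL-Algebra.Sylow"
    "HOL-Algebra.Ring"
    "HOL-Computational_Algebra.Polynomial_Factorial"
    "HOL-Analysis.Harmonic_Numbers"
begin

text \<open>
  Write \<open>q\<close> for the number of elements of the constant field and \<open>|M|\<close> for \<open>q ^ degree M\<close>.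
  For large \<open>T\<close>, an element \<open>k\<close> with \<open>|k| < q ^ T\<close> may only be represented by triples from a box
  with at most \<open>C q ^ T\<close> elements, where \<open>C = q powr (3 * A + 3)\<close>. So there is a bounded number of
  triples per \<open>k\<close>, which by itself excludes nothing when \<open>C \<ge> 1\<close>. But sums of three cubes are not
  equidistributed modulo a polynomial \<open>M\<close>. If \<open>x\<^sup>3 + y\<^sup>3 + z\<^sup>3 = a\<close> has at most
  \<open>\<epsilon> |M|\<^sup>2\<close> solutions modulo \<open>M\<close>, instead of the expected \<open>|M|\<^sup>2\<close>, then at most
  \<open>\<epsilon> C q ^ T / |M|\<close> triples of the box have a sum in the class of \<open>a\<close>, while the class has
  \<open>q ^ T / |M|\<close> elements of absolute value below \<open>q ^ T\<close>. With \<open>\<epsilon> = 1 / (2 * C)\<close> at least half of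
  the class is missed, for every large \<open>T\<close> and with \<open>M\<close> fixed, so that the upper density is at most
  \<open>1 - 1 / (2 * |M|)\<close>.

  It remains to find \<open>M\<close> and \<open>a\<close> for an arbitrary \<open>\<epsilon> > 0\<close> (\<open>ex_small_local_density\<close>). By the
  Chinese remainder theorem the local densities multiply over distinct primes. Modulo a prime \<open>P\<close>
  with \<open>|P| = Q \<equiv> 1 (mod 3)\<close> a noncube is a sum of three cubes in at most \<open>(Q - 1)\<^sup>2\<close> ways
  (\<open>cubic_count_noncube\<close>), so each such prime contributes a factor of at most
  \<open>(1 - 1 / Q)\<^sup>2\<close>. As the characteristic is not \<open>3\<close>, \<open>q\<^sup>2 \<equiv> 1 (mod 3)\<close>, and all primes of even
  degree qualify. There are at least \<open>q ^ (2 * m) / (4 * m)\<close> monic primes of degree \<open>2 * m \<ge> 4\<close>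
  (\<open>card_monic_irreducibles_even_ge\<close>), so the sum of \<open>1 / |P|\<close> over them diverges like the harmonic
  series and the product of the factors tends to \<open>0\<close>.

  The count over the residue field is elementary and uses neither character sums nor bounds of
  Hasse--Weil type. Fix a noncube \<open>g\<close> and compare the numbers of solutions of
  \<open>g^i x\<^sup>3 + g^j y\<^sup>3 + g^k z\<^sup>3 = b\<close> for all exponents. Since the three classes of nonzero elements
  modulo cubes together cover every element exactly three times by \<open>g^k z\<^sup>3\<close>, there are enough
  linear relations between these numbers to express the one for \<open>x\<^sup>3 + y\<^sup>3 + z\<^sup>3\<close> through the one for
  \<open>x\<^sup>3 + g y\<^sup>3 + g\<^sup>2 z\<^sup>3\<close>. The latter form is multiplied by \<open>g\<close> under a cyclic permutation of its
  variables, and this symmetry makes its count the same for all nonzero \<open>b\<close>.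
\<close>

section \<open>Sums of three cubes in a finite field\<close>

lemma sum_card_fibres:
  assumes "finite A" "finite B" "f ` A \<subseteq> B"
  shows "(\<Sum>b\<in>B. card {a \<in> A. f a = b}) = card A"
  using sum.group[OF assms, of "\<lambda>_. 1::nat"] by simp

lemma card_filter_eq_sum: "finite A \<Longrightarrow> card {x \<in> A. P x} = (\<Sum>x\<in>A. if P x then 1 else 0)"
  by (simp add: sum.If_cases Int_def)

lemma card_le_by_inj:
  assumes "finite B" "inj_on f A" "\<And>a. a \<in> A \<Longrightarrow> f a \<in> B"
  shows "card A \<le> card B"
  using assms by (intro card_inj_on_le[of f]) auto

lemma card_pairs_eq_sum:
  assumes "finite A" "finite B"
  shows "card {(x, y). x \<in> A \<and> y \<in> B \<and> P x y} = (\<Sum>x\<in>A. card {y \<in> B. P x y})"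
proof -
  have "{(x, y). x \<in> A \<and> y \<in> B \<and> P x y} = Sigma A (\<lambda>x. {y \<in> B. P x y})"
    by auto
  thus ?thesis
    using assms by simp
qed

lemma card_triples_eq_sum:
  assumes "finite A" "finite B" "finite C"
  shows "card {(x, y, z). x \<in> A \<and> y \<in> B \<and> z \<in> C \<and> P x y z} =
    (\<Sum>x\<in>A. \<Sum>y\<in>B. card {z \<in> C. P x y z})"
proof -
  have "{(x, y, z). x \<in> A \<and> y \<in> B \<and> z \<in> C \<and> P x y z} =
    Sigma A (\<lambda>x. Sigma B (\<lambda>y. {z \<in> C. P x y z}))"
    by auto
  thus ?thesis
    using assms by (simp add: card_SigmaI)
qed

context field
begin

lemma minus_eq_zero_iff:
  assumes "x \<in> carrier R" "y \<in> carrier R"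
  shows "x \<ominus> y = \<zero> \<longleftrightarrow> x = y"
proof
  assume "x \<ominus> y = \<zero>"
  moreover have "x = x \<ominus> y \<oplus> y" using assms by (simp add: minus_eq a_assoc l_neg)
  ultimately show "x = y" using assms by simp
qed (use assms in \<open>simp add: minus_eq r_neg\<close>)

text \<open>
  Sylow's theorem gives a subgroup of order \<open>3\<close> of the unit group.
\<close>

lemma ex_nontrivial_cube_root_of_one:
  assumes "finite (carrier R)" "3 dvd card (carrier R) - 1"
  obtains w where "w \<in> carrier R" "w \<noteq> \<one>" "w [^] (3::nat) = \<one>"
proof -
  interpret U: group "units_of R" by (rule units_group)
  from assms(2) obtain m where m: "card (carrier R) - 1 = 3 * m" by auto
  have "order (units_of R) = 3 ^ 1 * m"
    using assms(1) m by (simp add: order_def units_of_def field_Units card_Diff_singleton)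
  moreover have "finite (carrier (units_of R))"
    using assms(1) by (simp add: units_of_def field_Units)
  ultimately obtain H where H: "subgroup H (units_of R)" "card H = 3"
    using sylow_thm[of 3 "units_of R" 1 m] U.is_group by auto
  interpret H: subgroup H "units_of R" by fact
  interpret HG: comm_group "(units_of R)\<lparr>carrier := H\<rparr>"
    using H.subset U.subgroup_imp_group[OF H(1)]
    by (intro group.group_comm_groupI) (auto simp: units_of_def field_Units intro!: m_comm)
  have finH: "finite H" using H(2) by (metis card.infinite zero_neq_numeral)
  have one: "\<one> \<in> H" using H.one_closed by (simp add: units_of_def)
  have "H \<noteq> {\<one>}" using H(2) by auto
  then obtain w where w: "w \<in> H" "w \<noteq> \<one>" using one by auto
  have wR: "w \<in> carrier R" using w H.subset by (auto simp: units_of_def field_Units)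
  have "w [^]\<^bsub>(units_of R)\<lparr>carrier := H\<rparr>\<^esub> (3::nat) = \<one>"
    using HG.power_order_eq_one[of w] w H(2) finH by (simp add: order_def units_of_def)
  hence "w [^] (3::nat) = \<one>"
    using wR by (simp add: nat_pow_def units_of_def numeral_3_eq_3)
  with that w wR show ?thesis by blast
qed

lemma m_inv_field:
  assumes "x \<in> carrier R" "x \<noteq> \<zero>"
  shows "inv x \<in> carrier R" "inv x \<otimes> x = \<one>" "x \<otimes> inv x = \<one>"
  using assms field_Units by auto

lemma cube_root_of_one_quadratic:
  assumes "t \<in> carrier R" "t \<noteq> \<one>" "t [^] (3::nat) = \<one>"
  shows "t \<otimes> t \<oplus> t \<oplus> \<one> = \<zero>"
proof -
  have "(t \<ominus> \<one>) \<otimes> (t \<otimes> t \<oplus> t \<oplus> \<one>) = t \<otimes> t \<otimes> t \<ominus> \<one>"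
    using assms(1) by algebra
  also have "\<dots> = \<zero>" using assms by (simp add: numeral_3_eq_3 minus_eq r_neg)
  finally show ?thesis
    using assms by (simp add: integral_iff minus_eq_zero_iff)
qed

text \<open>
  Two roots \<open>t\<close> and \<open>w\<close> of \<open>X\<^sup>2 + X + 1\<close> satisfy \<open>(t - w) (t + w + 1) = 0\<close>, and
  \<open>- w - 1 = w\<^sup>2\<close>.
\<close>

lemma cube_root_of_one_cases:
  assumes w: "w \<in> carrier R" "w \<noteq> \<one>" "w [^] (3::nat) = \<one>"
    and t: "t \<in> carrier R" "t [^] (3::nat) = \<one>"
  shows "t = \<one> \<or> t = w \<or> t = w \<otimes> w"
proof (cases "t = \<one>")
  case False
  have "(t \<ominus> w) \<otimes> (t \<oplus> w \<oplus> \<one>) = (t \<otimes> t \<oplus> t \<oplus> \<one>) \<ominus> (w \<otimes> w \<oplus> w \<oplus> \<one>)"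
    using w(1) t(1) by algebra
  also have "\<dots> = \<zero>"
    using cube_root_of_one_quadratic[OF w] cube_root_of_one_quadratic[OF t(1) False t(2)]
    by (simp add: minus_eq_zero_iff)
  finally have "t = w \<or> t \<oplus> (w \<oplus> \<one>) = \<zero>"
    using w(1) t(1) by (simp add: integral_iff minus_eq_zero_iff a_assoc)
  moreover have "w \<otimes> w \<oplus> (w \<oplus> \<one>) = \<zero>"
    using cube_root_of_one_quadratic[OF w] w(1) by (simp add: a_assoc)
  ultimately show ?thesis
    using w(1) t(1) by (metis add.right_cancel a_closed m_closed one_closed)
qed simp

lemma card_same_cube:
  assumes "finite (carrier R)" "3 dvd card (carrier R) - 1" "u \<in> carrier R" "u \<noteq> \<zero>"
  shows "card {z \<in> carrier R. z [^] (3::nat) = u [^] (3::nat)} = 3"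
proof -
  obtain w where w: "w \<in> carrier R" "w \<noteq> \<one>" "w [^] (3::nat) = \<one>"
    using ex_nontrivial_cube_root_of_one assms by blast
  have eqv: "z [^] (3::nat) = u [^] (3::nat) \<longleftrightarrow> z = u \<or> z = w \<otimes> u \<or> z = w \<otimes> w \<otimes> u"
    if z: "z \<in> carrier R" for z
  proof
    note inv = m_inv_field[OF assms(3,4)]
    assume "z [^] (3::nat) = u [^] (3::nat)"
    moreover have "(y \<otimes> inv u) [^] (3::nat) = y [^] (3::nat) \<otimes> inv u [^] (3::nat)"
      if "y \<in> carrier R" for y
      using that inv by (intro nat_pow_distrib)
    ultimately have "(z \<otimes> inv u) [^] (3::nat) = (u \<otimes> inv u) [^] (3::nat)"
      using z assms w by (simp only:)
    hence "(z \<otimes> inv u) [^] (3::nat) = \<one>" using inv by simp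
    hence "z \<otimes> inv u = \<one> \<or> z \<otimes> inv u = w \<or> z \<otimes> inv u = w \<otimes> w"
      using cube_root_of_one_cases[OF w] z assms(3) inv by simp
    moreover have "z = z \<otimes> inv u \<otimes> u" using z assms w inv by (simp add: m_assoc)
    ultimately show "z = u \<or> z = w \<otimes> u \<or> z = w \<otimes> w \<otimes> u" using z assms w by auto
  next
    assume "z = u \<or> z = w \<otimes> u \<or> z = w \<otimes> w \<otimes> u"
    thus "z [^] (3::nat) = u [^] (3::nat)" using z assms w by (auto simp: nat_pow_distrib)
  qed
  have w0: "w \<noteq> \<zero>" using w(3) zero_not_one by (auto simp: numeral_3_eq_3)
  have d1: "w \<otimes> u \<noteq> u"
    using w(1,2) assms(3,4) by (metis l_one m_rcancel one_closed)
  have d2: "w \<otimes> w \<otimes> u \<noteq> w \<otimes> u"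
    using w(1,2) w0 assms(3,4) by (metis l_one m_rcancel one_closed m_closed)
  have d3: "w \<otimes> w \<otimes> u \<noteq> u"
  proof
    assume "w \<otimes> w \<otimes> u = u"
    hence "w \<otimes> w = \<one>" using w(1) assms(3,4) by (metis l_one m_rcancel one_closed m_closed)
    hence "w [^] (3::nat) = w" using w(1) by (simp add: numeral_3_eq_3)
    thus False using w by simp
  qed
  have "{z \<in> carrier R. z [^] (3::nat) = u [^] (3::nat)} = {u, w \<otimes> u, w \<otimes> w \<otimes> u}"
    using eqv w(1) assms(3) by auto
  thus ?thesis using d1 d2 d3 by auto
qed

lemma power3_eq_zero_iff:
  assumes "x \<in> carrier R"
  shows "x [^] (3::nat) = \<zero> \<longleftrightarrow> x = \<zero>"
  using assms by (simp add: numeral_3_eq_3 integral_iff)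

lemma zero_cube: "\<zero> [^] (3::nat) = \<zero>"
  by (simp add: numeral_3_eq_3)

text \<open>
  Cubing identifies \<open>1\<close> with a nontrivial cube root of one, so it is not injective and, the field
  being finite, not surjective.
\<close>

lemma ex_noncube:
  assumes "finite (carrier R)" "3 dvd card (carrier R) - 1"
  obtains g where "g \<in> carrier R" "g \<noteq> \<zero>" "\<And>u. u \<in> carrier R \<Longrightarrow> u [^] (3::nat) \<noteq> g"
proof -
  obtain w where w: "w \<in> carrier R" "w \<noteq> \<one>" "w [^] (3::nat) = \<one>"
    using ex_nontrivial_cube_root_of_one assms by blast
  define f where "f = (\<lambda>u. u [^] (3::nat))"
  have "\<not> inj_on f (carrier R)"
    using w inj_onD[of f "carrier R" w \<one>] by (auto simp: f_def)
  hence "\<not> carrier R \<subseteq> f ` carrier R"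
    using assms(1) by (metis finite_surj_inj)
  then obtain g where "g \<in> carrier R" "g \<notin> f ` carrier R" by blast
  moreover from this have "g \<noteq> \<zero>"
    by (auto simp: f_def image_iff numeral_3_eq_3 intro!: bexI[of _ \<zero>])
  ultimately show ?thesis using that by (auto simp: f_def)
qed

end

text \<open>
  The unit group modulo cubes has order \<open>3\<close> and is generated by the class of \<open>g\<close>. The exponents
  \<open>i < 3\<close> below index its three classes.
\<close>

locale cubic_twist = field R for R (structure) +
  fixes g
  assumes finite_carrier: "finite (carrier R)"
    and card_mod3: "3 dvd card (carrier R) - 1"
    and g_carrier: "g \<in> carrier R"
    and g_nonzero: "g \<noteq> \<zero>"
    and g_noncube: "\<And>u. u \<in> carrier R \<Longrightarrow> u [^] (3::nat) \<noteq> g"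
begin

abbreviation F where "F \<equiv> carrier R"

lemma two_le_card: "2 \<le> card F"
  using card_mono[OF finite_carrier, of "{\<zero>, \<one>}"] by simp

definition fibre :: "nat \<Rightarrow> 'a \<Rightarrow> nat" where
  "fibre i b = card {z \<in> F. g [^] i \<otimes> z [^] (3::nat) = b}"

lemma gpow: "g [^] (i::nat) \<in> F" "g [^] (i::nat) \<noteq> \<zero>"
  using g_carrier g_nonzero by (simp, induction i) (auto simp: integral_iff)

lemma g_powers: "g [^] (2::nat) = g \<otimes> g" "g [^] (3::nat) = g \<otimes> (g \<otimes> g)"
  using g_carrier by (simp_all add: numeral_2_eq_2 numeral_3_eq_3 m_assoc)

text \<open>
  Equality would make \<open>g\<close> or \<open>g\<^sup>2\<close> a cube \<open>w\<^sup>3\<close>. In the second case \<open>g = g\<^sup>3 / g\<^sup>2 = (g / w)\<^sup>3\<close>.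
\<close>

lemma fibre_disjoint:
  assumes "i < j" "j < 3" "u \<in> F" "v \<in> F" "v \<noteq> \<zero>"
  shows "g [^] (i::nat) \<otimes> u [^] (3::nat) \<noteq> g [^] j \<otimes> v [^] (3::nat)"
proof
  assume eq: "g [^] i \<otimes> u [^] (3::nat) = g [^] j \<otimes> v [^] (3::nat)"
  define w where "w = u \<otimes> inv v"
  have w: "w \<in> F" "w \<otimes> v = u"
    using assms m_inv_field[of v] by (auto simp: w_def m_assoc)
  have "g [^] i \<otimes> (w [^] (3::nat) \<otimes> v [^] (3::nat)) = g [^] i \<otimes> (g [^] (j - i) \<otimes> v [^] (3::nat))"
  proof -
    have "g [^] i \<otimes> (w [^] (3::nat) \<otimes> v [^] (3::nat)) = g [^] j \<otimes> v [^] (3::nat)"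
      using eq w assms by (simp flip: nat_pow_distrib)
    also have "g [^] j = g [^] i \<otimes> g [^] (j - i)"
      using assms g_carrier by (simp add: nat_pow_mult)
    finally show ?thesis using gpow assms by (simp add: m_assoc)
  qed
  hence "w [^] (3::nat) \<otimes> v [^] (3::nat) = g [^] (j - i) \<otimes> v [^] (3::nat)"
    using gpow w assms by (subst (asm) m_lcancel) auto
  hence cube: "w [^] (3::nat) = g [^] (j - i)"
    using gpow w assms by (subst (asm) m_rcancel) (auto simp: power3_eq_zero_iff)
  have "j - i = 1 \<or> j - i = 2" using assms by auto
  thus False
  proof
    assume "j - i = 1"
    thus False using cube w g_carrier g_noncube[of w] by simp
  next
    assume "j - i = 2"
    hence cube: "w [^] (3::nat) = g \<otimes> g" using cube g_carrier by (simp add: numeral_2_eq_2)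
    hence w0: "w \<noteq> \<zero>"
      using g_carrier g_nonzero integral_iff[of g g] by (auto simp: numeral_3_eq_3)
    have "(g \<otimes> inv w) [^] (3::nat) \<otimes> (g \<otimes> g) = (g \<otimes> inv w) [^] (3::nat) \<otimes> w [^] (3::nat)"
      by (simp add: cube)
    also have "\<dots> = (g \<otimes> inv w \<otimes> w) [^] (3::nat)"
      using w w0 g_carrier m_inv_field[of w] by (simp add: nat_pow_distrib)
    also have "g \<otimes> inv w \<otimes> w = g" using w w0 g_carrier m_inv_field[of w] by (simp add: m_assoc)
    also have "g [^] (3::nat) = g \<otimes> (g \<otimes> g)" using g_carrier by (simp add: numeral_3_eq_3 m_assoc)
    finally have "(g \<otimes> inv w) [^] (3::nat) = g"
      using w w0 g_carrier g_nonzero m_inv_field[of w]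
      by (subst (asm) m_rcancel) (auto simp: integral_iff)
    thus False using g_noncube w w0 m_inv_field[of w] g_carrier by auto
  qed
qed

lemma fibre_zero: "fibre i \<zero> = 1"
proof -
  have "{z \<in> F. g [^] i \<otimes> z [^] (3::nat) = \<zero>} = {\<zero>}"
    using gpow by (auto simp: integral_iff power3_eq_zero_iff)
  thus ?thesis by (simp add: fibre_def)
qed

lemma fibre_nonzero:
  assumes "u \<in> F" "u \<noteq> \<zero>"
  shows "fibre i (g [^] i \<otimes> u [^] (3::nat)) = 3"
proof -
  have "{z \<in> F. g [^] i \<otimes> z [^] (3::nat) = g [^] i \<otimes> u [^] (3::nat)} =
    {z \<in> F. z [^] (3::nat) = u [^] (3::nat)}"
    using gpow assms by (auto simp: m_lcancel)
  thus ?thesis using card_same_cube[OF finite_carrier card_mod3 assms] by (simp add: fibre_def)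
qed

lemma fibre_witness:
  assumes "fibre i b \<noteq> 0"
  obtains u where "u \<in> F" "b = g [^] i \<otimes> u [^] (3::nat)"
proof -
  from assms have "{z \<in> F. g [^] i \<otimes> z [^] (3::nat) = b} \<noteq> {}"
    unfolding fibre_def by (metis card.empty)
  with that show ?thesis by blast
qed

text \<open>
  At a nonzero \<open>b\<close> at most one of the three terms is nonzero, and it equals \<open>3\<close>; at \<open>0\<close> each of
  them is \<open>1\<close>.
\<close>

lemma sum_fibre_le:
  assumes "b \<in> F"
  shows "(\<Sum>i<3. fibre i b) \<le> 3"
proof (cases "b = \<zero> \<or> (\<forall>i<3. fibre i b = 0)")
  case True
  thus ?thesis by (auto simp: fibre_zero)
next
  case False
  then obtain i where i: "i < 3" "fibre i b \<noteq> 0" by auto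
  from i(2) obtain u where u: "u \<in> F" "b = g [^] i \<otimes> u [^] (3::nat)"
    by (rule fibre_witness)
  with False gpow have u0: "u \<noteq> \<zero>" by (auto simp: zero_cube)
  have "fibre j b = 0" if j: "j < 3" "j \<noteq> i" for j
  proof -
    have "{z \<in> F. g [^] j \<otimes> z [^] (3::nat) = b} = {}"
    proof (rule ccontr)
      assume "{z \<in> F. g [^] j \<otimes> z [^] (3::nat) = b} \<noteq> {}"
      then obtain z where z: "z \<in> F" "g [^] j \<otimes> z [^] (3::nat) = g [^] i \<otimes> u [^] (3::nat)"
        using u by auto
      with False gpow u(2) have "z \<noteq> \<zero>" by (auto simp: zero_cube)
      with z u u0 i j fibre_disjoint[of i j u z] fibre_disjoint[of j i z u] show False
        by (cases "i < j") auto
    qed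
    thus ?thesis unfolding fibre_def by (simp only: card.empty)
  qed
  hence "(\<Sum>j<3. fibre j b) = (\<Sum>j<3. if j = i then fibre i b else 0)"
    by (intro sum.cong) auto
  also have "\<dots> = 3" using i u u0 fibre_nonzero by simp
  finally show ?thesis by simp
qed

text \<open>
  Summed over all \<open>b\<close> both sides give \<open>3 * card F\<close>, so the bound of \<open>sum_fibre_le\<close> is attained
  everywhere. This shows without a computation of the index of the cubes that the three classes
  exhaust the nonzero elements (\<open>cube_class\<close>).
\<close>

lemma sum_fibre:
  assumes "b \<in> F"
  shows "(\<Sum>i<3. fibre i b) = 3"
proof -
  have "(\<Sum>b\<in>F. \<Sum>i<3. fibre i b) = (\<Sum>i<3. \<Sum>b\<in>F. fibre i b)" by (rule sum.swap)
  also have "\<dots> = (\<Sum>i<3::nat. card F)"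
    unfolding fibre_def using finite_carrier gpow by (intro sum.cong sum_card_fibres) auto
  also have "\<dots> = (\<Sum>b\<in>F. 3)" by simp
  finally show ?thesis
    using sum_mono_inv[of "\<lambda>b. \<Sum>i<3. fibre i b" F "\<lambda>_. 3" b] sum_fibre_le assms finite_carrier
    by auto
qed

lemma cube_class:
  assumes "b \<in> F" "b \<noteq> \<zero>"
  obtains i :: nat and u where "i < 3" "u \<in> F" "u \<noteq> \<zero>" "b = g [^] i \<otimes> u [^] (3::nat)"
proof -
  obtain i where i: "i < 3" "fibre i b \<noteq> 0"
    using sum_fibre[OF assms(1)] by (metis lessThan_iff sum.neutral zero_neq_numeral)
  from i(2) obtain u where u: "u \<in> F" "b = g [^] i \<otimes> u [^] (3::nat)"
    by (rule fibre_witness)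
  with assms gpow have u0: "u \<noteq> \<zero>" by (auto simp: zero_cube)
  with that i u show ?thesis by auto
qed

text \<open>
  Every nonzero \<open>c / b\<close> is a power of \<open>g\<close> times a cube, so a chain of the assumed inequalities leads
  from \<open>b\<close> to \<open>c\<close>, and another one back. Inequalities are convenient as hypotheses because an
  injection between solution sets provides each of them.
\<close>

lemma constant_on_units:
  fixes f :: "'a \<Rightarrow> nat"
  assumes g: "\<And>b. b \<in> F \<Longrightarrow> f b \<le> f (g \<otimes> b)"
    and cube: "\<And>b u. b \<in> F \<Longrightarrow> u \<in> F \<Longrightarrow> u \<noteq> \<zero> \<Longrightarrow> f b \<le> f (u [^] (3::nat) \<otimes> b)"
    and b: "b \<in> F" "b \<noteq> \<zero>" and c: "c \<in> F" "c \<noteq> \<zero>"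
  shows "f b = f c"
proof -
  have gi: "f b \<le> f (g [^] i \<otimes> b)" if "b \<in> F" for i :: nat and b
  proof (induction i)
    case (Suc i)
    have "f (g [^] i \<otimes> b) \<le> f (g \<otimes> (g [^] i \<otimes> b))" using gpow that by (intro g) auto
    also have "g \<otimes> (g [^] i \<otimes> b) = g [^] Suc i \<otimes> b"
      using gpow g_carrier that by (simp add: m_assoc[symmetric] m_comm)
    finally show ?case using Suc by simp
  qed (use that in simp)
  have le: "f b \<le> f c" if b: "b \<in> F" "b \<noteq> \<zero>" and c: "c \<in> F" "c \<noteq> \<zero>" for b c
  proof -
    note bi = m_inv_field[OF b]
    have "inv b \<noteq> \<zero>" using bi b by (metis l_null zero_not_one)
    hence "c \<otimes> inv b \<in> F" "c \<otimes> inv b \<noteq> \<zero>"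
      using b c bi by (auto simp: integral_iff)
    then obtain i :: nat and u where iu: "u \<in> F" "u \<noteq> \<zero>" "c \<otimes> inv b = g [^] i \<otimes> u [^] (3::nat)"
      using cube_class by metis
    have "f b \<le> f (u [^] (3::nat) \<otimes> b)" using b iu by (intro cube) auto
    also have "\<dots> \<le> f (g [^] i \<otimes> (u [^] (3::nat) \<otimes> b))" using b iu by (intro gi) auto
    also have "g [^] i \<otimes> (u [^] (3::nat) \<otimes> b) = c \<otimes> inv b \<otimes> b"
      using iu b gpow by (simp add: m_assoc)
    also have "\<dots> = c" using b bi c by (simp add: m_assoc)
    finally show ?thesis .
  qed
  show ?thesis using le b c by (intro antisym) auto
qed

definition cubic_count :: "nat \<Rightarrow> nat \<Rightarrow> nat \<Rightarrow> 'a \<Rightarrow> nat" where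
  "cubic_count i j k b = card {(x, y, z). x \<in> F \<and> y \<in> F \<and> z \<in> F \<and>
     g [^] i \<otimes> x [^] (3::nat) \<oplus> g [^] j \<otimes> y [^] (3::nat) \<oplus> g [^] k \<otimes> z [^] (3::nat) = b}"

lemma finite_triples: "finite {(x, y, z). x \<in> F \<and> y \<in> F \<and> z \<in> F \<and> P x y z}"
  by (rule finite_subset[of _ "F \<times> F \<times> F"]) (use finite_carrier in auto)

lemma cubic_count_le:
  assumes "inj_on f (F \<times> F \<times> F)" "f ` (F \<times> F \<times> F) \<subseteq> F \<times> F \<times> F"
    and "\<And>x y z. x \<in> F \<Longrightarrow> y \<in> F \<Longrightarrow> z \<in> F \<Longrightarrow>
      g [^] i \<otimes> x [^] (3::nat) \<oplus> g [^] j \<otimes> y [^] (3::nat) \<oplus> g [^] k \<otimes> z [^] (3::nat) = b \<Longrightarrow>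
      (case f (x, y, z) of (x, y, z) \<Rightarrow>
        g [^] i' \<otimes> x [^] (3::nat) \<oplus> g [^] j' \<otimes> y [^] (3::nat) \<oplus> g [^] k' \<otimes> z [^] (3::nat)) = b'"
  shows "cubic_count i j k b \<le> cubic_count i' j' k' b'"
  unfolding cubic_count_def
proof (rule card_le_by_inj[where f = f])
  show "finite {(x, y, z). x \<in> F \<and> y \<in> F \<and> z \<in> F \<and>
     g [^] i' \<otimes> x [^] (3::nat) \<oplus> g [^] j' \<otimes> y [^] (3::nat) \<oplus> g [^] k' \<otimes> z [^] (3::nat) = b'}"
    by (rule finite_triples)
  show "inj_on f {(x, y, z). x \<in> F \<and> y \<in> F \<and> z \<in> F \<and>
     g [^] i \<otimes> x [^] (3::nat) \<oplus> g [^] j \<otimes> y [^] (3::nat) \<oplus> g [^] k \<otimes> z [^] (3::nat) = b}"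
    using assms(1) by (rule inj_on_subset) auto
  fix a assume "a \<in> {(x, y, z). x \<in> F \<and> y \<in> F \<and> z \<in> F \<and>
     g [^] i \<otimes> x [^] (3::nat) \<oplus> g [^] j \<otimes> y [^] (3::nat) \<oplus> g [^] k \<otimes> z [^] (3::nat) = b}"
  then obtain x y z where a: "a = (x, y, z)" "x \<in> F" "y \<in> F" "z \<in> F"
     "g [^] i \<otimes> x [^] (3::nat) \<oplus> g [^] j \<otimes> y [^] (3::nat) \<oplus> g [^] k \<otimes> z [^] (3::nat) = b"
    by auto
  moreover have "f a \<in> F \<times> F \<times> F" using a assms(2) by auto
  ultimately show "f a \<in> {(x, y, z). x \<in> F \<and> y \<in> F \<and> z \<in> F \<and>
     g [^] i' \<otimes> x [^] (3::nat) \<oplus> g [^] j' \<otimes> y [^] (3::nat) \<oplus> g [^] k' \<otimes> z [^] (3::nat) = b'}"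
    using assms(3)[of x y z] by (auto split: prod.splits)
qed

lemma cubic_count_swap12: "cubic_count i j k b = cubic_count j i k b"
proof (rule antisym)
  show "cubic_count i j k b \<le> cubic_count j i k b" for i j k
  proof (rule cubic_count_le[of "\<lambda>(x, y, z). (y, x, z)"])
    fix x y z assume xyz: "x \<in> F" "y \<in> F" "z \<in> F"
      and eq: "g [^] i \<otimes> x [^] (3::nat) \<oplus> g [^] j \<otimes> y [^] (3::nat) \<oplus> g [^] k \<otimes> z [^] (3::nat) = b"
    have "g [^] j \<otimes> y [^] (3::nat) \<oplus> g [^] i \<otimes> x [^] (3::nat) =
      g [^] i \<otimes> x [^] (3::nat) \<oplus> g [^] j \<otimes> y [^] (3::nat)"
      using xyz gpow by (intro a_comm) auto
    with eq show "(case case (x, y, z) of (x, y, z) \<Rightarrow> (y, x, z) of (x, y, z) \<Rightarrow>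
       g [^] j \<otimes> x [^] (3::nat) \<oplus> g [^] i \<otimes> y [^] (3::nat) \<oplus> g [^] k \<otimes> z [^] (3::nat)) = b"
      by simp
  qed (auto simp: inj_on_def)
  thus "cubic_count j i k b \<le> cubic_count i j k b" .
qed

lemma cubic_count_swap23: "cubic_count i j k b = cubic_count i k j b"
proof (rule antisym)
  show "cubic_count i j k b \<le> cubic_count i k j b" for i j k
  proof (rule cubic_count_le[of "\<lambda>(x, y, z). (x, z, y)"])
    fix x y z assume xyz: "x \<in> F" "y \<in> F" "z \<in> F"
      and eq: "g [^] i \<otimes> x [^] (3::nat) \<oplus> g [^] j \<otimes> y [^] (3::nat) \<oplus> g [^] k \<otimes> z [^] (3::nat) = b"
    have "g [^] i \<otimes> x [^] (3::nat) \<oplus> g [^] k \<otimes> z [^] (3::nat) \<oplus> g [^] j \<otimes> y [^] (3::nat) =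
      g [^] i \<otimes> x [^] (3::nat) \<oplus> (g [^] j \<otimes> y [^] (3::nat) \<oplus> g [^] k \<otimes> z [^] (3::nat))"
      using xyz gpow by (subst a_assoc, simp, simp, simp) (intro arg_cong2[of _ _ _ _ "(\<oplus>)"] refl a_comm, auto)
    also have "\<dots> = b" unfolding eq[symmetric] using xyz gpow by (intro a_assoc[symmetric]) auto
    finally show "(case case (x, y, z) of (x, y, z) \<Rightarrow> (x, z, y) of (x, y, z) \<Rightarrow>
       g [^] i \<otimes> x [^] (3::nat) \<oplus> g [^] k \<otimes> y [^] (3::nat) \<oplus> g [^] j \<otimes> z [^] (3::nat)) = b"
      by simp
  qed (auto simp: inj_on_def)
  thus "cubic_count i k j b \<le> cubic_count i j k b" .
qed

lemma add_eq_iff_eq_minus: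
  assumes "s \<in> F" "t \<in> F" "b \<in> F"
  shows "s \<oplus> t = b \<longleftrightarrow> t = b \<ominus> s"
proof
  assume "s \<oplus> t = b"
  moreover have "t = s \<oplus> t \<ominus> s" using assms by (simp add: minus_eq a_comm[of s t] a_assoc r_neg)
  ultimately show "t = b \<ominus> s" by simp
next
  assume "t = b \<ominus> s"
  thus "s \<oplus> t = b" using assms by (simp add: minus_eq a_ac r_neg r_neg1)
qed

lemma cubic_count_eq_sum:
  assumes "b \<in> F"
  shows "cubic_count i j k b =
    (\<Sum>x\<in>F. \<Sum>y\<in>F. fibre k (b \<ominus> (g [^] i \<otimes> x [^] (3::nat) \<oplus> g [^] j \<otimes> y [^] (3::nat))))"
  unfolding cubic_count_def card_triples_eq_sum[OF finite_carrier finite_carrier finite_carrier]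
    fibre_def
  using gpow assms by (intro sum.cong refl arg_cong[of _ _ card] Collect_cong conj_cong add_eq_iff_eq_minus) simp_all

text \<open>
  For given \<open>x\<close> and \<open>y\<close>, \<open>sum_fibre\<close> says that the remainder \<open>b - g^i x\<^sup>3 - g^j y\<^sup>3\<close> is of the form
  \<open>g^k z\<^sup>3\<close> for exactly three pairs \<open>(k, z)\<close>.
\<close>

lemma sum_cubic_count_third:
  assumes "b \<in> F"
  shows "(\<Sum>k<3. cubic_count i j k b) = 3 * card F ^ 2"
proof -
  have "(\<Sum>k<3. cubic_count i j k b) =
    (\<Sum>x\<in>F. \<Sum>y\<in>F. \<Sum>k<3. fibre k (b \<ominus> (g [^] i \<otimes> x [^] (3::nat) \<oplus> g [^] j \<otimes> y [^] (3::nat))))"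
    unfolding cubic_count_eq_sum[OF assms]
    by (subst sum.swap, intro sum.cong refl, subst sum.swap, intro sum.cong refl)
  also have "\<dots> = (\<Sum>x\<in>F. \<Sum>y\<in>F. 3)"
    using gpow assms by (intro sum.cong refl sum_fibre) auto
  finally show ?thesis by (simp add: power2_eq_square)
qed

text \<open>
  The form \<open>x\<^sup>3 + g y\<^sup>3 + g\<^sup>2 z\<^sup>3\<close> is multiplied by \<open>g\<close> when \<open>(x, y, z)\<close> is replaced by
  \<open>(g z, x, y)\<close>, and by \<open>u\<^sup>3\<close> when the variables are scaled by \<open>u\<close>.
\<close>

lemma cubic_count_norm_constant:
  assumes "b \<in> F" "b \<noteq> \<zero>" "c \<in> F" "c \<noteq> \<zero>"
  shows "cubic_count 0 1 2 b = cubic_count 0 1 2 c"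
proof (rule constant_on_units[OF _ _ assms])
  fix b assume b: "b \<in> F"
  show "cubic_count 0 1 2 b \<le> cubic_count 0 1 2 (g \<otimes> b)"
  proof (rule cubic_count_le[of "\<lambda>(x, y, z). (g \<otimes> z, x, y)"])
    fix x y z assume xyz: "x \<in> F" "y \<in> F" "z \<in> F" and eq:
      "g [^] (0::nat) \<otimes> x [^] (3::nat) \<oplus> g [^] (1::nat) \<otimes> y [^] (3::nat) \<oplus> g [^] (2::nat) \<otimes> z [^] (3::nat) = b"
    have "g [^] (0::nat) \<otimes> (g \<otimes> z) [^] (3::nat) \<oplus> g [^] (1::nat) \<otimes> x [^] (3::nat) \<oplus> g [^] (2::nat) \<otimes> y [^] (3::nat)
      = g \<otimes> (g [^] (0::nat) \<otimes> x [^] (3::nat) \<oplus> g [^] (1::nat) \<otimes> y [^] (3::nat) \<oplus> g [^] (2::nat) \<otimes> z [^] (3::nat))"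
      using xyz g_carrier g_powers by (simp add: nat_pow_distrib r_distr m_assoc a_ac)
    also have "\<dots> = g \<otimes> b" by (simp only: eq)
    finally show "(case case (x, y, z) of (x, y, z) \<Rightarrow> (g \<otimes> z, x, y) of (x, y, z) \<Rightarrow>
       g [^] (0::nat) \<otimes> x [^] (3::nat) \<oplus> g [^] (1::nat) \<otimes> y [^] (3::nat) \<oplus> g [^] (2::nat) \<otimes> z [^] (3::nat)) = g \<otimes> b"
      by simp
  qed (use g_carrier g_nonzero in \<open>auto simp: inj_on_def m_lcancel\<close>)
next
  fix b u assume b: "b \<in> F" and u: "u \<in> F" "u \<noteq> \<zero>"
  have scale: "a \<otimes> (v \<otimes> x) \<oplus> b \<otimes> (v \<otimes> y) \<oplus> c \<otimes> (v \<otimes> z) = v \<otimes> (a \<otimes> x \<oplus> b \<otimes> y \<oplus> c \<otimes> z)"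
    if "a \<in> F" "b \<in> F" "c \<in> F" "v \<in> F" "x \<in> F" "y \<in> F" "z \<in> F" for a b c v x y z
    using that by (simp add: r_distr m_lcomm)
  show "cubic_count 0 1 2 b \<le> cubic_count 0 1 2 (u [^] (3::nat) \<otimes> b)"
  proof (rule cubic_count_le[of "\<lambda>(x, y, z). (u \<otimes> x, u \<otimes> y, u \<otimes> z)"])
    fix x y z assume xyz: "x \<in> F" "y \<in> F" "z \<in> F" and
      "g [^] (0::nat) \<otimes> x [^] (3::nat) \<oplus> g [^] (1::nat) \<otimes> y [^] (3::nat) \<oplus> g [^] (2::nat) \<otimes> z [^] (3::nat) = b"
    hence "b = g [^] (0::nat) \<otimes> x [^] (3::nat) \<oplus> g [^] (1::nat) \<otimes> y [^] (3::nat) \<oplus> g [^] (2::nat) \<otimes> z [^] (3::nat)"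
      by simp
    hence "g [^] (0::nat) \<otimes> (u \<otimes> x) [^] (3::nat) \<oplus> g [^] (1::nat) \<otimes> (u \<otimes> y) [^] (3::nat)
      \<oplus> g [^] (2::nat) \<otimes> (u \<otimes> z) [^] (3::nat) = u [^] (3::nat) \<otimes> b"
      using xyz gpow u scale by (simp only: nat_pow_distrib nat_pow_closed)
    thus "(case case (x, y, z) of (x, y, z) \<Rightarrow> (u \<otimes> x, u \<otimes> y, u \<otimes> z) of (x, y, z) \<Rightarrow>
       g [^] (0::nat) \<otimes> x [^] (3::nat) \<oplus> g [^] (1::nat) \<otimes> y [^] (3::nat) \<oplus> g [^] (2::nat) \<otimes> z [^] (3::nat)) =
       u [^] (3::nat) \<otimes> b"
      by simp
  qed (use u in \<open>auto simp: inj_on_def m_lcancel\<close>)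
qed

text \<open>
  With \<open>Q = card F\<close>, the \<open>Q\<^sup>3\<close> triples are spread evenly over the \<open>Q - 1\<close> nonzero values, apart from
  those with value \<open>0\<close>. Already the zero triple lowers the common count to at most
  \<open>(Q\<^sup>3 - 1) / (Q - 1) = Q\<^sup>2 + Q + 1\<close>.
\<close>

lemma cubic_count_norm_le:
  assumes "b \<in> F" "b \<noteq> \<zero>"
  shows "cubic_count 0 1 2 b \<le> card F ^ 2 + card F + 1"
proof -
  define Q where "Q = card F"
  have Q: "Q \<ge> 2" unfolding Q_def by (rule two_le_card)
  have pos: "cubic_count 0 1 2 \<zero> \<ge> 1"
  proof -
    have "(\<zero>, \<zero>, \<zero>) \<in> {(x, y, z). x \<in> F \<and> y \<in> F \<and> z \<in> F \<and>
      g [^] (0::nat) \<otimes> x [^] (3::nat) \<oplus> g [^] (1::nat) \<otimes> y [^] (3::nat) \<oplus> g [^] (2::nat) \<otimes> z [^] (3::nat) = \<zero>}"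
      using gpow g_carrier by (simp add: numeral_3_eq_3)
    moreover have "finite {(x, y, z). x \<in> F \<and> y \<in> F \<and> z \<in> F \<and>
      g [^] (0::nat) \<otimes> x [^] (3::nat) \<oplus> g [^] (1::nat) \<otimes> y [^] (3::nat) \<oplus> g [^] (2::nat) \<otimes> z [^] (3::nat) = \<zero>}"
      by (rule finite_triples)
    ultimately show ?thesis unfolding cubic_count_def
      by (metis (no_types, lifting) One_nat_def Suc_leI card_gt_0_iff empty_iff)
  qed
  have "(\<Sum>c\<in>F. cubic_count 0 1 2 c) = Q ^ 3"
  proof -
    define f where "f = (\<lambda>(x, y, z). g [^] (0::nat) \<otimes> x [^] (3::nat) \<oplus> g [^] (1::nat) \<otimes> y [^] (3::nat) \<oplus> g [^] (2::nat) \<otimes> z [^] (3::nat))"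
    have "(\<Sum>c\<in>F. cubic_count 0 1 2 c) = (\<Sum>c\<in>F. card {t \<in> F \<times> F \<times> F. f t = c})"
      unfolding cubic_count_def f_def by (intro sum.cong arg_cong[of _ _ card]) auto
    also have "\<dots> = card (F \<times> F \<times> F)"
      using finite_carrier gpow g_carrier by (intro sum_card_fibres) (auto simp: f_def)
    finally show ?thesis by (simp add: Q_def card_cartesian_product power3_eq_cube)
  qed
  also have "(\<Sum>c\<in>F. cubic_count 0 1 2 c) = cubic_count 0 1 2 \<zero> + (\<Sum>c\<in>F - {\<zero>}. cubic_count 0 1 2 c)"
    using finite_carrier by (intro sum.remove) auto
  also have "(\<Sum>c\<in>F - {\<zero>}. cubic_count 0 1 2 c) = (\<Sum>c\<in>F - {\<zero>}. cubic_count 0 1 2 b)"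
    using assms by (intro sum.cong cubic_count_norm_constant) auto
  also have "\<dots> = (Q - 1) * cubic_count 0 1 2 b"
    using finite_carrier by (simp add: Q_def card_Diff_singleton)
  finally have "(Q - 1) * cubic_count 0 1 2 b \<le> Q ^ 3 - 1" using pos by linarith
  also have "Q ^ 3 - 1 = (Q - 1) * (Q ^ 2 + Q + 1)"
    using Q by (cases Q) (auto simp: algebra_simps power2_eq_square power3_eq_cube)
  finally have "cubic_count 0 1 2 b \<le> Q ^ 2 + Q + 1"
    using Q by (subst (asm) mult_le_cancel1) auto
  thus ?thesis unfolding Q_def .
qed

definition pair_count :: "'a \<Rightarrow> nat" where
  "pair_count s = (\<Sum>i<3::nat. card {(x, y). x \<in> F \<and> y \<in> F \<and>
     g [^] i \<otimes> (x [^] (3::nat) \<oplus> y [^] (3::nat)) = s})"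

lemma finite_pairs: "finite {(x, y). x \<in> F \<and> y \<in> F \<and> P x y}"
  by (rule finite_subset[of _ "F \<times> F"]) (use finite_carrier in auto)

text \<open>
  Multiplication by \<open>g\<close> shifts the exponent \<open>i\<close>, and \<open>g\<^sup>3\<close> is absorbed by scaling \<open>x\<close> and \<open>y\<close>
  by \<open>g\<close>.
\<close>

lemma pair_count_constant:
  assumes "b \<in> F" "b \<noteq> \<zero>" "c \<in> F" "c \<noteq> \<zero>"
  shows "pair_count b = pair_count c"
proof (rule constant_on_units[OF _ _ assms])
  fix b assume b: "b \<in> F"
  define r where "r = (\<lambda>(i::nat) s. card {(x, y). x \<in> F \<and> y \<in> F \<and>
     g [^] i \<otimes> (x [^] (3::nat) \<oplus> y [^] (3::nat)) = s})"
  have "r i b \<le> r (Suc i) (g \<otimes> b)" for i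
    unfolding r_def using finite_pairs
  proof (rule card_mono, safe)
    fix x y assume "x \<in> F" "y \<in> F"
    thus "g [^] Suc i \<otimes> (x [^] (3::nat) \<oplus> y [^] (3::nat)) =
      g \<otimes> (g [^] i \<otimes> (x [^] (3::nat) \<oplus> y [^] (3::nat)))"
      using g_carrier gpow m_comm[of "g [^] i" g] by (simp add: m_assoc[symmetric])
  qed
  moreover have "r 2 b \<le> r 0 (g \<otimes> b)"
    unfolding r_def
  proof (rule card_le_by_inj[where f = "\<lambda>(x, y). (g \<otimes> x, g \<otimes> y)"])
    fix a assume "a \<in> {(x, y). x \<in> F \<and> y \<in> F \<and> g [^] (2::nat) \<otimes> (x [^] (3::nat) \<oplus> y [^] (3::nat)) = b}"
    then obtain x y where a: "a = (x, y)" "x \<in> F" "y \<in> F"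
      "b = g [^] (2::nat) \<otimes> (x [^] (3::nat) \<oplus> y [^] (3::nat))" by auto
    have "g [^] (0::nat) \<otimes> ((g \<otimes> x) [^] (3::nat) \<oplus> (g \<otimes> y) [^] (3::nat)) = g \<otimes> b"
      unfolding a(4) using a(2,3) g_carrier g_powers by (simp add: nat_pow_distrib r_distr m_assoc)
    thus "(case a of (x, y) \<Rightarrow> (g \<otimes> x, g \<otimes> y)) \<in> {(x, y). x \<in> F \<and> y \<in> F \<and>
        g [^] (0::nat) \<otimes> (x [^] (3::nat) \<oplus> y [^] (3::nat)) = g \<otimes> b}"
      using a g_carrier by auto
  qed (use finite_pairs g_carrier g_nonzero in \<open>auto simp: inj_on_def m_lcancel\<close>)
  ultimately have "r 0 b + r 1 b + r 2 b \<le> r 1 (g \<otimes> b) + r 2 (g \<otimes> b) + r 0 (g \<otimes> b)"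
    by (intro add_mono) (metis One_nat_def, metis Suc_1, simp)
  thus "pair_count b \<le> pair_count (g \<otimes> b)"
    by (simp add: pair_count_def r_def numeral_3_eq_3 numeral_2_eq_2)
next
  fix b u assume b: "b \<in> F" and u: "u \<in> F" "u \<noteq> \<zero>"
  have scale: "a \<otimes> (v \<otimes> x \<oplus> v \<otimes> y) = v \<otimes> (a \<otimes> (x \<oplus> y))"
    if "a \<in> F" "v \<in> F" "x \<in> F" "y \<in> F" for a v x y
    using that by (simp add: r_distr m_lcomm)
  show "pair_count b \<le> pair_count (u [^] (3::nat) \<otimes> b)"
    unfolding pair_count_def
  proof (intro sum_mono card_le_by_inj[where f = "\<lambda>(x, y). (u \<otimes> x, u \<otimes> y)"])
    fix i :: nat and a
    assume "a \<in> {(x, y). x \<in> F \<and> y \<in> F \<and> g [^] i \<otimes> (x [^] (3::nat) \<oplus> y [^] (3::nat)) = b}"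
    thus "(case a of (x, y) \<Rightarrow> (u \<otimes> x, u \<otimes> y)) \<in> {(x, y). x \<in> F \<and> y \<in> F \<and>
        g [^] i \<otimes> (x [^] (3::nat) \<oplus> y [^] (3::nat)) = u [^] (3::nat) \<otimes> b}"
      using u gpow scale by (auto simp: nat_pow_distrib)
  qed (use finite_pairs u in \<open>auto simp: inj_on_def m_lcancel\<close>)
qed

text \<open>
  Because \<open>- x\<^sup>3\<close> is the cube of \<open>- x\<close>, each nonzero \<open>x\<close> has three partners \<open>y\<close> with
  \<open>x\<^sup>3 + y\<^sup>3 = 0\<close>, and \<open>x = 0\<close> has one.
\<close>

lemma pair_count_zero: "pair_count \<zero> = 3 * (3 * card F - 2)"
proof -
  have "card {(x, y). x \<in> F \<and> y \<in> F \<and> g [^] (i::nat) \<otimes> (x [^] (3::nat) \<oplus> y [^] (3::nat)) = \<zero>} =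
    3 * card F - 2" for i
  proof -
    have "{(x, y). x \<in> F \<and> y \<in> F \<and> g [^] i \<otimes> (x [^] (3::nat) \<oplus> y [^] (3::nat)) = \<zero>} =
      Sigma F (\<lambda>x. {y \<in> F. y [^] (3::nat) = (\<ominus> x) [^] (3::nat)})"
    proof -
      have "x [^] (3::nat) \<oplus> y [^] (3::nat) = \<zero> \<longleftrightarrow> y [^] (3::nat) = (\<ominus> x) [^] (3::nat)"
        if "x \<in> F" "y \<in> F" for x y
      proof -
        have "(\<ominus> x) [^] (3::nat) = \<zero> \<ominus> x [^] (3::nat)" using that by (simp add: numeral_3_eq_3 l_minus r_minus minus_eq)
        thus ?thesis using that by (simp add: add_eq_iff_eq_minus)
      qed
      thus ?thesis using gpow by (auto simp: integral_iff)
    qed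
    hence "card {(x, y). x \<in> F \<and> y \<in> F \<and> g [^] i \<otimes> (x [^] (3::nat) \<oplus> y [^] (3::nat)) = \<zero>} =
      (\<Sum>x\<in>F. card {y \<in> F. y [^] (3::nat) = (\<ominus> x) [^] (3::nat)})"
      using finite_carrier by simp
    also have "\<dots> = (\<Sum>x\<in>F. if x = \<zero> then 1 else 3)"
    proof (intro sum.cong refl)
      fix x assume x: "x \<in> F"
      show "card {y \<in> F. y [^] (3::nat) = (\<ominus> x) [^] (3::nat)} = (if x = \<zero> then 1 else 3)"
      proof (cases "x = \<zero>")
        case True
        hence "{y \<in> F. y [^] (3::nat) = (\<ominus> x) [^] (3::nat)} = {\<zero>}"
          by (auto simp: numeral_3_eq_3 integral_iff)
        thus ?thesis using True by simp
      next
        case False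
        hence "\<ominus> x \<noteq> \<zero>" using x by (metis minus_minus minus_zero)
        thus ?thesis using x False card_same_cube[OF finite_carrier card_mod3, of "\<ominus> x"] by simp
      qed
    qed
    also have "\<dots> = 1 + (\<Sum>x\<in>F - {\<zero>}. 3)"
      using finite_carrier by (subst sum.remove[of _ \<zero>]) (auto intro!: sum.cong)
    also have "\<dots> = 3 * card F - 2"
      using finite_carrier card_gt_0_iff[of F] by (cases "card F") (auto simp: card_Diff_singleton)
    finally show ?thesis .
  qed
  thus ?thesis by (simp add: pair_count_def)
qed

text \<open>
  With \<open>Q = card F\<close>, the \<open>3 Q\<^sup>2\<close> triples \<open>(i, x, y)\<close> minus the \<open>3 (3 Q - 2)\<close> with value \<open>0\<close> are
  shared equally by the \<open>Q - 1\<close> nonzero values, and \<open>3 Q\<^sup>2 - 3 (3 Q - 2) = (Q - 1) (3 Q - 6)\<close>.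
\<close>

lemma pair_count_nonzero:
  assumes "b \<in> F" "b \<noteq> \<zero>"
  shows "pair_count b + 6 = 3 * card F"
proof -
  define Q where "Q = card F"
  have Q: "Q \<ge> 2" unfolding Q_def by (rule two_le_card)
  have "(\<Sum>c\<in>F. pair_count c) = (\<Sum>i<3::nat. \<Sum>c\<in>F. card {(x, y). x \<in> F \<and> y \<in> F \<and>
     g [^] i \<otimes> (x [^] (3::nat) \<oplus> y [^] (3::nat)) = c})"
    unfolding pair_count_def by (rule sum.swap)
  also have "\<dots> = (\<Sum>i<3::nat. Q ^ 2)"
  proof (intro sum.cong refl)
    fix i :: nat
    define f where "f = (\<lambda>(x, y). g [^] i \<otimes> (x [^] (3::nat) \<oplus> y [^] (3::nat)))"
    have "(\<Sum>c\<in>F. card {(x, y). x \<in> F \<and> y \<in> F \<and>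
      g [^] i \<otimes> (x [^] (3::nat) \<oplus> y [^] (3::nat)) = c}) = (\<Sum>c\<in>F. card {t \<in> F \<times> F. f t = c})"
      unfolding f_def by (intro sum.cong arg_cong[of _ _ card]) auto
    also have "\<dots> = card (F \<times> F)"
      using finite_carrier gpow by (intro sum_card_fibres) (auto simp: f_def)
    finally show "(\<Sum>c\<in>F. card {(x, y). x \<in> F \<and> y \<in> F \<and>
      g [^] i \<otimes> (x [^] (3::nat) \<oplus> y [^] (3::nat)) = c}) = Q ^ 2"
      by (simp add: card_cartesian_product Q_def power2_eq_square)
  qed
  also have "(\<Sum>c\<in>F. pair_count c) = pair_count \<zero> + (\<Sum>c\<in>F - {\<zero>}. pair_count c)"
    using finite_carrier by (intro sum.remove) auto
  also have "(\<Sum>c\<in>F - {\<zero>}. pair_count c) = (\<Sum>c\<in>F - {\<zero>}. pair_count b)"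
    using assms by (intro sum.cong pair_count_constant) auto
  also have "\<dots> = (Q - 1) * pair_count b"
    using finite_carrier by (simp add: Q_def card_Diff_singleton)
  finally have eq: "3 * (3 * Q - 2) + (Q - 1) * pair_count b = 3 * Q ^ 2"
    by (simp add: pair_count_zero Q_def)
  obtain m where m: "Q = m + 2" using Q by (metis add.commute le_Suc_ex)
  have "(m + 1) * pair_count b = (m + 1) * (3 * m)"
    using eq unfolding m by (simp add: power2_eq_square algebra_simps)
  hence "pair_count b = 3 * m" by (metis mult_cancel1 add_is_0 one_neq_zero)
  thus ?thesis using m by (simp add: Q_def)
qed

text \<open>
  For a noncube \<open>b\<close> the difference \<open>b - z\<^sup>3\<close> never vanishes, so every \<open>z\<close> contributes the constant
  value \<open>3 * card F - 6\<close> of \<open>pair_count\<close> at nonzero elements. For a cube \<open>b\<close> the count would be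
  larger.
\<close>

lemma sum_cubic_count_diagonal:
  assumes "b \<in> F" "\<And>u. u \<in> F \<Longrightarrow> u [^] (3::nat) \<noteq> b"
  shows "(\<Sum>i<3. cubic_count i i 0 b) + 6 * card F = 3 * card F ^ 2"
proof -
  have "cubic_count i i 0 b = (\<Sum>z\<in>F. card {(x, y). x \<in> F \<and> y \<in> F \<and>
     g [^] i \<otimes> (x [^] (3::nat) \<oplus> y [^] (3::nat)) = b \<ominus> z [^] (3::nat)})" for i
  proof -
    have key: "g [^] (0::nat) \<otimes> z [^] (3::nat) \<oplus> g [^] i \<otimes> x [^] (3::nat) \<oplus> g [^] i \<otimes> y [^] (3::nat) = b \<longleftrightarrow>
      g [^] i \<otimes> (x [^] (3::nat) \<oplus> y [^] (3::nat)) = b \<ominus> z [^] (3::nat)"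
      if "x \<in> F" "y \<in> F" "z \<in> F" for x y z
      using add_eq_iff_eq_minus[of "z [^] (3::nat)" "g [^] i \<otimes> (x [^] (3::nat) \<oplus> y [^] (3::nat))" b]
        that assms(1) gpow by (simp add: r_distr a_assoc)
    have "cubic_count i i 0 b = cubic_count 0 i i b"
      using cubic_count_swap12 cubic_count_swap23 by metis
    also have "\<dots> = (\<Sum>z\<in>F. \<Sum>x\<in>F. card {y \<in> F.
      g [^] i \<otimes> (x [^] (3::nat) \<oplus> y [^] (3::nat)) = b \<ominus> z [^] (3::nat)})"
      unfolding cubic_count_def card_triples_eq_sum[OF finite_carrier finite_carrier finite_carrier]
      by (intro sum.cong refl arg_cong[of _ _ card] Collect_cong conj_cong key)
    finally show ?thesis
      by (simp add: card_pairs_eq_sum[OF finite_carrier finite_carrier])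
  qed
  hence "(\<Sum>i<3. cubic_count i i 0 b) = (\<Sum>z\<in>F. pair_count (b \<ominus> z [^] (3::nat)))"
    unfolding pair_count_def by (simp add: sum.swap[of _ F])
  also have "\<dots> + 6 * card F = (\<Sum>z\<in>F. pair_count (b \<ominus> z [^] (3::nat)) + 6)"
    by (simp add: sum.distrib)
  also have "\<dots> = (\<Sum>z\<in>F. 3 * card F)"
    using assms minus_eq_zero_iff by (intro sum.cong refl pair_count_nonzero) force+
  finally show ?thesis by (simp add: power2_eq_square)
qed

text \<open>
  Write \<open>N i j k\<close> for \<open>cubic_count i j k b\<close>, which is symmetric in the exponents. Three relations
  with total \<open>3 Q\<^sup>2\<close> come from \<open>sum_cubic_count_third\<close>, for the exponents \<open>0 0\<close>, \<open>0 1\<close> and \<open>0 2\<close>,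
  and one from \<open>sum_cubic_count_diagonal\<close>. Eliminating \<open>N 0 0 1\<close>, \<open>N 0 0 2\<close> and
  \<open>N 1 1 0 + N 2 2 0\<close> leaves \<open>N 0 0 0 + 3 Q = N 0 1 2 \<le> Q\<^sup>2 + Q + 1\<close>.
\<close>

theorem cubic_count_noncube:
  assumes "b \<in> F" "\<And>u. u \<in> F \<Longrightarrow> u [^] (3::nat) \<noteq> b"
  shows "cubic_count 0 0 0 b \<le> (card F - 1) ^ 2"
proof -
  have b0: "b \<noteq> \<zero>" using assms(2)[of \<zero>] by (auto simp: numeral_3_eq_3)
  have Q: "card F \<ge> 2" by (rule two_le_card)
  have "cubic_count 0 0 0 b + cubic_count 0 0 1 b + cubic_count 0 0 2 b = 3 * card F ^ 2"
    using sum_cubic_count_third[OF assms(1), of 0 0] by (simp add: numeral_3_eq_3 numeral_2_eq_2)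
  moreover have "cubic_count 0 0 1 b + cubic_count 1 1 0 b + cubic_count 0 1 2 b = 3 * card F ^ 2"
    using sum_cubic_count_third[OF assms(1), of 0 1] cubic_count_swap12 cubic_count_swap23
    by (simp add: numeral_3_eq_3 numeral_2_eq_2)
  moreover have "cubic_count 0 0 2 b + cubic_count 0 1 2 b + cubic_count 2 2 0 b = 3 * card F ^ 2"
    using sum_cubic_count_third[OF assms(1), of 0 2] cubic_count_swap12 cubic_count_swap23
    by (simp add: numeral_3_eq_3 numeral_2_eq_2)
  moreover have "cubic_count 0 0 0 b + cubic_count 1 1 0 b + cubic_count 2 2 0 b + 6 * card F = 3 * card F ^ 2"
    using sum_cubic_count_diagonal[OF assms] by (simp add: numeral_3_eq_3 numeral_2_eq_2)
  ultimately have "cubic_count 0 0 0 b + 3 * card F = cubic_count 0 1 2 b" by linarith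
  also have "\<dots> \<le> card F ^ 2 + card F + 1" by (rule cubic_count_norm_le[OF assms(1) b0])
  also have "\<dots> = (card F - 1) ^ 2 + 3 * card F"
    using Q by (cases "card F") (auto simp: power2_eq_square algebra_simps)
  finally show ?thesis by simp
qed

end

section \<open>Residue fields of polynomial rings\<close>

definition polys_below :: "nat \<Rightarrow> 'a::zero poly set" where
  "polys_below n = {p. \<forall>i\<ge>n. coeff p i = 0}"

lemma polys_below_iff: "p \<in> polys_below n \<longleftrightarrow> p = 0 \<or> degree p < n"
proof
  assume p: "p \<in> polys_below n"
  show "p = 0 \<or> degree p < n"
  proof (cases "degree p < n")
    case False
    hence "lead_coeff p = 0" using p by (simp add: polys_below_def)
    thus ?thesis by simp
  qed simp
qed (auto simp: polys_below_def coeff_eq_0)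

lemma polys_below_0: "polys_below 0 = {0}"
  by (auto simp: polys_below_iff)

lemma polys_below_Suc: "polys_below (Suc n) = (\<lambda>(a, p). pCons a p) ` (UNIV \<times> polys_below n)"
proof (intro equalityI subsetI)
  fix p :: "'a poly" assume p: "p \<in> polys_below (Suc n)"
  obtain a q where q: "p = pCons a q" by (cases p)
  have "coeff q i = 0" if "i \<ge> n" for i
  proof -
    have "coeff p (Suc i) = 0" using p that by (simp add: polys_below_def)
    thus ?thesis by (simp add: q)
  qed
  thus "p \<in> (\<lambda>(a, p). pCons a p) ` (UNIV \<times> polys_below n)"
    using q by (auto simp: polys_below_def)
qed (auto simp: polys_below_def coeff_pCons split: nat.splits)

lemma finite_polys_below: "finite (polys_below n :: 'a::{finite,zero} poly set)"
  by (induction n) (auto simp: polys_below_0 polys_below_Suc)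

lemma card_polys_below: "card (polys_below n :: 'a::{finite,zero} poly set) = CARD('a) ^ n"
proof (induction n)
  case (Suc n)
  have "card (polys_below (Suc n) :: 'a poly set) = card ((UNIV :: 'a set) \<times> (polys_below n :: 'a poly set))"
    unfolding polys_below_Suc by (intro card_image) (auto simp: inj_on_def)
  thus ?case using Suc by (simp add: card_cartesian_product)
qed (simp add: polys_below_0)

lemma two_le_CARD: "2 \<le> CARD('a::{finite,field})"
  using card_mono[of UNIV "{0::'a, 1}"] by simp

lemma polys_below_arith:
  fixes p r :: "'a::ring poly"
  assumes "p \<in> polys_below n" "r \<in> polys_below n"
  shows "p + r \<in> polys_below n" "- p \<in> polys_below n"
  using assms by (auto simp: polys_below_def)

lemma mod_in_polys_below: "M \<noteq> 0 \<Longrightarrow> p mod M \<in> polys_below (degree M)" for M :: "'a::field poly"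
  using degree_mod_less by (auto simp: polys_below_iff)

lemma mod_polys_below: "p \<in> polys_below (degree M) \<Longrightarrow> p mod M = p" for M :: "'a::field poly"
  by (auto simp: polys_below_iff mod_poly_less)

text \<open>
  Multiplication by \<open>a\<close> permutes the finite set of residues modulo \<open>P\<close>.
\<close>

lemma ex_mult_mod_eq:
  fixes P :: "'a::{field,finite} poly"
  assumes "irreducible P" "\<not> P dvd a"
  shows "\<exists>y\<in>polys_below (degree P). a * y mod P = w mod P"
proof -
  have prime: "prime_elem P" by (rule field_poly_irreducible_imp_prime[OF assms(1)])
  have P0: "P \<noteq> 0" using assms by auto
  have "inj_on (\<lambda>y. a * y mod P) (polys_below (degree P))"
  proof (rule inj_onI)
    fix y z assume yz: "y \<in> polys_below (degree P)" "z \<in> polys_below (degree P)"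
      "a * y mod P = a * z mod P"
    hence "P dvd a * (y - z)" by (simp add: mod_eq_dvd_iff right_diff_distrib)
    hence "P dvd y - z" using prime assms(2) by (simp add: prime_elem_dvd_mult_iff)
    hence "y mod P = z mod P" by (simp add: mod_eq_dvd_iff)
    thus "y = z" using yz by (simp add: mod_polys_below)
  qed
  hence "(\<lambda>y. a * y mod P) ` polys_below (degree P) = polys_below (degree P)"
    using finite_polys_below P0 by (intro endo_inj_surj) (auto simp: mod_in_polys_below)
  moreover have "w mod P \<in> polys_below (degree P)" using P0 by (rule mod_in_polys_below)
  ultimately show ?thesis by (metis (lifting) imageE)
qed

definition poly_residue_ring :: "'a::field poly \<Rightarrow> 'a poly ring" where
  "poly_residue_ring M = \<lparr>carrier = polys_below (degree M), mult = (\<lambda>x y. x * y mod M), one = 1,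
    zero = 0, add = (+)\<rparr>"

lemma poly_residue_ring_simps:
  "carrier (poly_residue_ring M) = polys_below (degree M)"
  "x \<otimes>\<^bsub>poly_residue_ring M\<^esub> y = x * y mod M"
  "\<one>\<^bsub>poly_residue_ring M\<^esub> = 1"
  "\<zero>\<^bsub>poly_residue_ring M\<^esub> = 0"
  "x \<oplus>\<^bsub>poly_residue_ring M\<^esub> y = x + y"
  by (simp_all add: poly_residue_ring_def)

lemma field_poly_residue_ring:
  fixes P :: "'a::{field,finite} poly"
  assumes "irreducible P"
  shows "Ring.field (poly_residue_ring P)"
proof -
  have prime: "prime_elem P" by (rule field_poly_irreducible_imp_prime[OF assms])
  have P0: "P \<noteq> 0" using assms by auto
  have deg: "degree P > 0"
    using assms P0 by (auto simp: irreducible_def is_unit_iff_degree)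
  have "cring (poly_residue_ring P)"
  proof (rule cringI)
    show "abelian_group (poly_residue_ring P)"
    proof (rule abelian_groupI)
      fix x assume "x \<in> carrier (poly_residue_ring P)"
      thus "\<exists>y\<in>carrier (poly_residue_ring P). y \<oplus>\<^bsub>poly_residue_ring P\<^esub> x = \<zero>\<^bsub>poly_residue_ring P\<^esub>"
        by (intro bexI[of _ "- x"]) (auto simp: poly_residue_ring_simps polys_below_arith)
    qed (auto simp: poly_residue_ring_simps polys_below_arith polys_below_iff[of 0])
    show "comm_monoid (poly_residue_ring P)"
    proof (rule comm_monoidI)
      show "\<one>\<^bsub>poly_residue_ring P\<^esub> \<in> carrier (poly_residue_ring P)"
        using deg by (simp add: poly_residue_ring_simps polys_below_iff)
    qed (auto simp: poly_residue_ring_simps mod_in_polys_below P0 mod_mult_left_eq mod_mult_right_eq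
        mod_polys_below ac_simps)
  qed (auto simp: poly_residue_ring_simps distrib_right poly_mod_add_left)
  then interpret cring "poly_residue_ring P" .
  show ?thesis
  proof (rule cring_fieldI2)
    show "\<zero>\<^bsub>poly_residue_ring P\<^esub> \<noteq> \<one>\<^bsub>poly_residue_ring P\<^esub>"
      by (simp add: poly_residue_ring_simps)
    fix a assume a: "a \<in> carrier (poly_residue_ring P)" "a \<noteq> \<zero>\<^bsub>poly_residue_ring P\<^esub>"
    have na: "\<not> P dvd a"
      using a by (auto simp: poly_residue_ring_simps polys_below_iff dest: dvd_imp_degree_le)
    then obtain y where y: "y \<in> polys_below (degree P)" "a * y mod P = 1 mod P"
      using ex_mult_mod_eq[OF assms] by blast
    moreover have "1 mod P = 1" using deg by (intro mod_poly_less) simp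
    ultimately have "\<exists>y\<in>polys_below (degree P). a * y mod P = 1" by auto
    thus "\<exists>b\<in>carrier (poly_residue_ring P). a \<otimes>\<^bsub>poly_residue_ring P\<^esub> b = \<one>\<^bsub>poly_residue_ring P\<^esub>"
      by (simp add: poly_residue_ring_simps)
  qed
qed

text \<open>
  Otherwise Sylow's theorem gives a nonzero \<open>x\<close> with \<open>3 x = 0\<close>.
\<close>

lemma three_not_dvd_CARD:
  assumes "CHAR('a::{finite,field}) \<noteq> 3"
  shows "\<not> 3 dvd CARD('a)"
proof
  assume "3 dvd CARD('a)"
  then obtain m where m: "CARD('a) = 3 * m" by blast
  define G :: "'a monoid" where "G = \<lparr>carrier = UNIV, monoid.mult = (+), one = 0\<rparr>"
  interpret G: comm_group G
    by (rule comm_groupI) (auto simp: G_def ac_simps intro: exI[of _ "- _"])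
  obtain H where H: "subgroup H G" "card H = 3"
    using sylow_thm[of 3 G 1 m] m G.is_group by (auto simp: G_def order_def)
  interpret H: subgroup H G by fact
  interpret HG: comm_group "G\<lparr>carrier := H\<rparr>"
    using G.subgroup_imp_group[OF H(1)]
    by (intro group.group_comm_groupI) (auto simp: G_def ac_simps)
  have "0 \<in> H" using H.one_closed by (simp add: G_def)
  moreover have "H \<noteq> {0}" using H(2) by auto
  ultimately obtain x where x: "x \<in> H" "x \<noteq> 0" by auto
  have "finite H" using H(2) by (metis card.infinite zero_neq_numeral)
  hence "x [^]\<^bsub>G\<lparr>carrier := H\<rparr>\<^esub> (3::nat) = \<one>\<^bsub>G\<^esub>"
    using HG.power_order_eq_one[of x] x H(2) by simp
  hence "x + x + x = 0"
    by (simp add: nat_pow_def G_def numeral_3_eq_3)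
  hence "of_nat 3 * x = 0" by (simp add: algebra_simps)
  hence "of_nat 3 = (0 :: 'a)" using x(2) by (metis mult_eq_0_iff)
  hence "CHAR('a) dvd 3" by (simp only: of_nat_eq_0_iff_char_dvd)
  moreover have "prime (3::nat)" by simp
  moreover have "CHAR('a) \<noteq> 1" by simp
  ultimately show False using assms by (metis prime_nat_iff)
qed

lemma three_dvd_power_even:
  fixes q :: nat
  assumes "\<not> 3 dvd q" "even n"
  shows "3 dvd q ^ n - 1"
proof -
  have "q mod 3 = 1 \<or> q mod 3 = 2" using assms(1) by presburger
  hence "q ^ 2 mod 3 = 1"
    using power_mod[of q 3 2] by auto
  hence "(q ^ 2) ^ (n div 2) mod 3 = 1"
    using power_mod[of "q ^ 2" 3 "n div 2"] by simp
  hence "q ^ n mod 3 = 1" using assms(2) by (simp flip: power_mult)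
  thus ?thesis by (metis dvd_minus_mod)
qed

text \<open>
  The solutions of \<open>x\<^sup>3 + y\<^sup>3 + z\<^sup>3 \<equiv> a (mod M)\<close>, each residue class being represented by its
  element of degree less than \<open>degree M\<close>.
\<close>

definition cube_sols :: "'a::field poly \<Rightarrow> 'a poly \<Rightarrow> ('a poly \<times> 'a poly \<times> 'a poly) set" where
  "cube_sols M a = {(x, y, z). x \<in> polys_below (degree M) \<and> y \<in> polys_below (degree M) \<and>
     z \<in> polys_below (degree M) \<and> M dvd x ^ 3 + y ^ 3 + z ^ 3 - a}"

text \<open>
  An even degree makes \<open>|P| \<equiv> 1 (mod 3)\<close>, so the residue field has a noncube.
\<close>

lemma ex_few_cube_sols_prime:
  fixes P :: "'a::{field,finite} poly"
  assumes "irreducible P" "even (degree P)" "CHAR('a) \<noteq> 3"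
  shows "\<exists>a. card (cube_sols P a) \<le> (CARD('a) ^ degree P - 1) ^ 2"
proof -
  let ?R = "poly_residue_ring P"
  interpret field ?R by (rule field_poly_residue_ring[OF assms(1)])
  have card: "card (carrier ?R) = CARD('a) ^ degree P"
    by (simp add: poly_residue_ring_simps card_polys_below)
  have fin: "finite (carrier ?R)"
    by (simp add: poly_residue_ring_simps finite_polys_below)
  have dvd3: "3 dvd card (carrier ?R) - 1"
    unfolding card by (intro three_dvd_power_even three_not_dvd_CARD assms)
  obtain g where g: "g \<in> carrier ?R" "g \<noteq> \<zero>\<^bsub>?R\<^esub>"
    "\<And>u. u \<in> carrier ?R \<Longrightarrow> u [^]\<^bsub>?R\<^esub> (3::nat) \<noteq> g"
    using ex_noncube[OF fin dvd3] by metis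
  interpret cubic_twist ?R g
    by unfold_locales (use fin dvd3 g in auto)
  have cube: "x [^]\<^bsub>?R\<^esub> (3::nat) = x ^ 3 mod P" if "x \<in> polys_below (degree P)" for x
    using that by (simp add: nat_pow_def numeral_3_eq_3 poly_residue_ring_simps mod_mult_left_eq
        mod_mult_right_eq mod_polys_below ac_simps)
  have P0: "P \<noteq> 0" using assms(1) by auto
  have key: "P dvd x ^ 3 + y ^ 3 + z ^ 3 - g \<longleftrightarrow>
      g [^]\<^bsub>?R\<^esub> (0::nat) \<otimes>\<^bsub>?R\<^esub> x [^]\<^bsub>?R\<^esub> (3::nat) \<oplus>\<^bsub>?R\<^esub>
      g [^]\<^bsub>?R\<^esub> (0::nat) \<otimes>\<^bsub>?R\<^esub> y [^]\<^bsub>?R\<^esub> (3::nat) \<oplus>\<^bsub>?R\<^esub>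
      g [^]\<^bsub>?R\<^esub> (0::nat) \<otimes>\<^bsub>?R\<^esub> z [^]\<^bsub>?R\<^esub> (3::nat) = g"
    if "x \<in> polys_below (degree P)" "y \<in> polys_below (degree P)" "z \<in> polys_below (degree P)" for x y z
  proof -
    have "P dvd x ^ 3 + y ^ 3 + z ^ 3 - g \<longleftrightarrow> (x ^ 3 + y ^ 3 + z ^ 3) mod P = g mod P"
      by (simp add: mod_eq_dvd_iff)
    also have "(x ^ 3 + y ^ 3 + z ^ 3) mod P = x ^ 3 mod P + y ^ 3 mod P + z ^ 3 mod P"
      by (simp add: poly_mod_add_left)
    also have "g mod P = g" using g by (simp add: poly_residue_ring_simps mod_polys_below)
    finally show ?thesis
      using that P0 by (simp add: cube poly_residue_ring_simps)
  qed
  have "card (cube_sols P g) = cubic_count 0 0 0 g"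
    unfolding cubic_count_def cube_sols_def poly_residue_ring_simps(1) by (simp only: key cong: conj_cong)
  also have "\<dots> \<le> (CARD('a) ^ degree P - 1) ^ 2"
    using cubic_count_noncube[OF g(1,3)] by (simp add: card)
  finally show ?thesis by blast
qed

section \<open>Counting irreducible polynomials\<close>

definition monic_polys :: "nat \<Rightarrow> 'a::field poly set" where
  "monic_polys n = {f. degree f = n \<and> lead_coeff f = 1}"

text \<open>
  The monic irreducible polynomials are the primes of the polynomial ring up to units.
\<close>

definition monic_irreducibles :: "nat \<Rightarrow> 'a::field poly set" where
  "monic_irreducibles n = {P \<in> monic_polys n. irreducible P}"

lemma monic_polys_eq: "monic_polys n = (\<lambda>p. monom 1 n + p) ` (polys_below n)"
proof (intro equalityI subsetI)
  fix f :: "'a poly" assume f: "f \<in> monic_polys n"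
  have "f - monom 1 n \<in> polys_below n"
    unfolding polys_below_def
  proof safe
    fix i assume "n \<le> i"
    thus "coeff (f - monom 1 n) i = 0"
      using f by (cases "i = n") (auto simp: monic_polys_def coeff_eq_0)
  qed
  thus "f \<in> (\<lambda>p. monom 1 n + p) ` (polys_below n)"
    by (intro image_eqI[of _ _ "f - monom 1 n"]) auto
next
  fix f :: "'a poly" assume "f \<in> (\<lambda>p. monom 1 n + p) ` (polys_below n)"
  then obtain p where p: "f = monom 1 n + p" "p \<in> polys_below n" by auto
  have "coeff f n = 1" using p by (simp add: polys_below_def)
  moreover have "degree f \<le> n"
    using p by (intro degree_le) (auto simp: polys_below_def)
  ultimately have "degree f = n" by (intro antisym le_degree) auto
  with \<open>coeff f n = 1\<close> show "f \<in> monic_polys n" by (simp add: monic_polys_def)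
qed

lemma finite_monic_polys: "finite (monic_polys n :: 'a::{finite,field} poly set)"
  by (simp add: monic_polys_eq finite_polys_below)

lemma finite_monic_irreducibles: "finite (monic_irreducibles n :: 'a::{finite,field} poly set)"
  by (simp add: monic_irreducibles_def finite_monic_polys)

lemma card_monic_polys: "card (monic_polys n :: 'a::{finite,field} poly set) = CARD('a) ^ n"
  unfolding monic_polys_eq by (subst card_image) (auto simp: inj_on_def card_polys_below)

lemma monic_polys_mult:
  "f \<in> monic_polys m \<Longrightarrow> g \<in> monic_polys n \<Longrightarrow> f * g \<in> monic_polys (m + n)"
proof -
  assume fg: "f \<in> monic_polys m" "g \<in> monic_polys n"
  hence "f \<noteq> 0" "g \<noteq> 0" by (auto simp: monic_polys_def)
  thus ?thesis using fg by (auto simp: monic_polys_def degree_mult_eq coeff_mult_degree_sum)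
qed

lemma monic_polys_power: "f \<in> monic_polys m \<Longrightarrow> f ^ j \<in> monic_polys (j * m)"
  by (induction j) (auto simp: monic_polys_mult, simp add: monic_polys_def)

lemma monic_polys_divide:
  assumes "h \<in> monic_polys k" "h * g \<in> monic_polys n"
  shows "g \<in> monic_polys (n - k)" "k \<le> n"
proof -
  have "h \<noteq> 0" "g \<noteq> 0" using assms by (auto simp: monic_polys_def)
  thus "g \<in> monic_polys (n - k)" "k \<le> n"
    using assms by (auto simp: monic_polys_def degree_mult_eq coeff_mult_degree_sum)
qed

lemma card_monic_multiples:
  fixes h :: "'a::{finite,field} poly"
  assumes "h \<in> monic_polys k"
  shows "card {f \<in> monic_polys n. h dvd f} = (if k \<le> n then CARD('a) ^ (n - k) else 0)"
proof (cases "k \<le> n")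
  case True
  have "{f \<in> monic_polys n. h dvd f} = (\<lambda>g. h * g) ` monic_polys (n - k)"
    using monic_polys_divide[OF assms] monic_polys_mult[OF assms, of _ "n - k"] True
    by (auto simp: image_iff elim!: dvdE)
  moreover have "h \<noteq> 0" using assms by (auto simp: monic_polys_def)
  ultimately show ?thesis
    using True by (simp add: card_image inj_on_def card_monic_polys)
next
  case False
  hence "{f \<in> monic_polys n. h dvd f} = {}"
    using monic_polys_divide(2)[OF assms] by (auto elim!: dvdE)
  thus ?thesis using False by (simp only: card.empty if_False)
qed

text \<open>
  A nonunit divisor of least degree is irreducible. Dividing it by its leading coefficient makes it
  monic.
\<close>

lemma ex_monic_irreducible_factor:
  fixes f :: "'a::field poly"
  assumes "degree f > 0"
  obtains P where "P \<in> monic_irreducibles (degree P)" "P dvd f"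
proof -
  have "f \<noteq> 0" using assms by auto
  hence f: "f \<noteq> 0" "\<not> is_unit f" using assms by (auto simp: is_unit_iff_degree)
  define P where "P = (ARG_MIN degree P. P dvd f \<and> \<not> is_unit P)"
  have P: "P dvd f" "\<not> is_unit P"
    using arg_min_natI[of "\<lambda>P. P dvd f \<and> \<not> is_unit P" f degree] f by (auto simp: P_def)
  have P0: "P \<noteq> 0" using P f by auto
  have "irreducible P"
  proof (rule irreducibleI)
    fix a b assume ab: "P = a * b"
    show "is_unit a \<or> is_unit b"
    proof (rule ccontr)
      assume "\<not> (is_unit a \<or> is_unit b)"
      moreover have "a dvd f" using P(1) ab by (metis dvd_mult_left)
      ultimately have "degree P \<le> degree a"
        unfolding P_def by (intro arg_min_nat_le) auto
      moreover have "degree P = degree a + degree b" "degree b > 0"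
        using ab P0 \<open>\<not> (is_unit a \<or> is_unit b)\<close> by (auto simp: degree_mult_eq is_unit_iff_degree)
      ultimately show False by simp
    qed
  qed (use P P0 in auto)
  define c where "c = inverse (lead_coeff P)"
  have c: "c \<noteq> 0" using P0 by (simp add: c_def)
  have eq: "smult c P = [:c:] * P" by simp
  have "is_unit [:c:]" using c by (rule is_unit_triv)
  hence "irreducible (smult c P)"
    using \<open>irreducible P\<close> irreducible_mult_unit_left[of "[:c:]" P] unfolding eq by blast
  moreover have "smult c P dvd f" using P(1) c by (simp add: smult_dvd_iff)
  moreover have "lead_coeff (smult c P) = 1" using P0 by (simp add: c_def)
  ultimately show ?thesis
    using that[of "smult c P"] by (auto simp: monic_irreducibles_def monic_polys_def)
qed

lemma monic_irreducible_prime: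
  "P \<in> monic_irreducibles n \<Longrightarrow> prime_elem P" for P :: "'a::field poly"
  using field_poly_irreducible_imp_prime by (auto simp: monic_irreducibles_def)

lemma monic_irreducible_degree_pos:
  "P \<in> monic_irreducibles n \<Longrightarrow> degree P > 0" for P :: "'a::field poly"
  by (auto simp: monic_irreducibles_def irreducible_def is_unit_iff_degree)

lemma monic_irreducible_dvd_iff:
  fixes P R :: "'a::field poly"
  assumes "P \<in> monic_irreducibles m" "R \<in> monic_irreducibles n"
  shows "P dvd R \<longleftrightarrow> P = R"
proof
  assume "P dvd R"
  then obtain c where c: "R = P * c" by auto
  have "\<not> is_unit P" using assms by (auto simp: monic_irreducibles_def irreducible_def)
  hence "is_unit c" using c assms by (auto simp: monic_irreducibles_def irreducible_def)
  then obtain u where u: "c = [:u:]" by (auto elim: is_unit_polyE)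
  have "lead_coeff R = lead_coeff P * u" using c u by (simp add: lead_coeff_mult)
  hence "u = 1" using assms by (auto simp: monic_irreducibles_def monic_polys_def)
  thus "P = R" using c u by simp
qed simp

lemma prime_power_dvd_mult_cancel:
  fixes P Q h :: "'a::field poly"
  assumes "prime_elem Q" "\<not> Q dvd P"
  shows "Q ^ j dvd P * h \<longleftrightarrow> Q ^ j dvd h"
proof
  assume "Q ^ j dvd P * h"
  thus "Q ^ j dvd h"
  proof (induction j arbitrary: h)
    case (Suc j)
    have "Q dvd P * h" using Suc.prems by (metis dvd_mult_left power_Suc)
    hence "Q dvd h" using assms by (simp add: prime_elem_dvd_mult_iff)
    then obtain h' where h': "h = Q * h'" by auto
    have "Q \<noteq> 0" using assms(1) by auto
    hence "Q ^ j dvd P * h'" using Suc.prems by (simp add: h' mult.left_commute)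
    with Suc.IH[of h'] show ?case by (simp add: h')
  qed simp
qed simp

text \<open>
  Unique factorization in terms of degrees: the cardinality is the exponent of \<open>P\<close> in \<open>f\<close>. The
  induction splits off one irreducible factor of \<open>f\<close>, which raises its own exponent by one and no
  other. The common bound \<open>N\<close> on degrees and exponents lets the index sets stay the same meanwhile.
\<close>

lemma degree_eq_sum_exponents:
  fixes f :: "'a::{finite,field} poly"
  assumes "lead_coeff f = 1" "degree f \<le> N"
  shows "degree f = (\<Sum>P\<in>(\<Union>d\<in>{1..N}. monic_irreducibles d). card {j \<in> {1..N}. P ^ j dvd f} * degree P)"
  using assms
proof (induction "degree f" arbitrary: f rule: less_induct)
  case less
  let ?I = "\<Union>d\<in>{1..N}. monic_irreducibles d :: 'a poly set"
  have fin: "finite ?I" by (auto simp: finite_monic_irreducibles)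
  have no_power: "\<not> P ^ j dvd f" if "P \<in> ?I" "j > degree f" "f \<noteq> 0" for P f :: "'a poly" and j
  proof
    assume "P ^ j dvd f"
    have "degree P > 0" using that monic_irreducible_degree_pos by auto
    moreover from this have "P \<noteq> 0" by auto
    ultimately have "j \<le> degree (P ^ j)" by (simp add: degree_power_eq)
    also have "\<dots> \<le> degree f" using \<open>P ^ j dvd f\<close> that by (intro dvd_imp_degree_le) auto
    finally show False using that by simp
  qed
  show ?case
  proof (cases "degree f = 0")
    case True
    moreover have "f \<noteq> 0" using less.prems by auto
    ultimately have "{j \<in> {1..N}. P ^ j dvd f} = {}" if "P \<in> ?I" for P
      using no_power[OF that, of f] by auto
    hence "(\<Sum>P\<in>?I. card {j \<in> {1..N}. P ^ j dvd f} * degree P) = 0"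
      by (intro sum.neutral ballI) (simp only: card.empty mult_0)
    thus ?thesis using True by simp
  next
    case False
    then obtain P where P: "P \<in> monic_irreducibles (degree P)" "P dvd f"
      using ex_monic_irreducible_factor by blast
    then obtain h where h: "f = P * h" by auto
    have nz: "P \<noteq> 0" "h \<noteq> 0" using less.prems h by auto
    have deg: "degree f = degree P + degree h" using nz h by (simp add: degree_mult_eq)
    have hm: "lead_coeff h = 1"
      using less.prems P h by (auto simp: lead_coeff_mult monic_irreducibles_def monic_polys_def)
    note Pdeg = monic_irreducible_degree_pos[OF P(1)]
    have PI: "P \<in> ?I" using P Pdeg deg less.prems by auto
    have step: "card {j \<in> {1..N}. Q ^ j dvd f} = (if Q = P then 1 else 0) + card {j \<in> {1..N}. Q ^ j dvd h}"
      if Q: "Q \<in> ?I" for Q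
    proof (cases "Q = P")
      case True
      have "{j \<in> {1..N}. P ^ j dvd f} = Suc ` insert 0 {j \<in> {1..N}. P ^ j dvd h}"
      proof (intro equalityI subsetI)
        fix j assume j: "j \<in> {j \<in> {1..N}. P ^ j dvd f}"
        then obtain i where i: "j = Suc i" by (cases j) auto
        with j show "j \<in> Suc ` insert 0 {j \<in> {1..N}. P ^ j dvd h}"
          using nz by (auto simp: h image_iff)
      next
        fix j assume j: "j \<in> Suc ` insert 0 {j \<in> {1..N}. P ^ j dvd h}"
        then obtain i where i: "j = Suc i" "i = 0 \<or> P ^ i dvd h" by auto
        have "i \<le> degree h" using no_power[OF PI, of h i] i nz by (cases "i = 0") (auto simp: not_less[symmetric])
        hence "j \<le> N" using i deg less.prems Pdeg by simp
        thus "j \<in> {j \<in> {1..N}. P ^ j dvd f}" using i by (auto simp: h)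
      qed
      moreover have "card (Suc ` insert 0 {j \<in> {1..N}. P ^ j dvd h}) = 1 + card {j \<in> {1..N}. P ^ j dvd h}"
        by (subst card_image) auto
      ultimately show ?thesis using True by (simp only: simp_thms if_True)
    next
      case False
      have "\<not> Q dvd P" "prime_elem Q"
        using Q P(1) False monic_irreducible_dvd_iff monic_irreducible_prime by blast+
      thus ?thesis using False by (simp add: h prime_power_dvd_mult_cancel)
    qed
    have "(\<Sum>Q\<in>?I. card {j \<in> {1..N}. Q ^ j dvd f} * degree Q) =
      (\<Sum>Q\<in>?I. (if Q = P then degree P else 0) + card {j \<in> {1..N}. Q ^ j dvd h} * degree Q)"
      by (intro sum.cong refl) (simp only: step, simp add: distrib_right)
    also have "\<dots> = degree P + (\<Sum>Q\<in>?I. card {j \<in> {1..N}. Q ^ j dvd h} * degree Q)"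
      using PI fin by (subst sum.distrib) simp
    also have "\<dots> = degree f"
      using less.hyps[of h] deg Pdeg hm less.prems by simp
    finally show ?thesis by simp
  qed
qed

text \<open>
  This is the sum of the von Mangoldt function (the degree of \<open>P\<close> at a power of a prime \<open>P\<close>, and
  zero elsewhere) over the monic polynomials of degree \<open>k\<close>. The first argument only fixes the
  coefficient field.
\<close>

definition prime_weight :: "'a::{finite,field} itself \<Rightarrow> nat \<Rightarrow> nat" where
  "prime_weight _ k = (\<Sum>d | d dvd k \<and> d \<in> {1..k}. d * card (monic_irreducibles d :: 'a poly set))"

text \<open>
  Double counting: the degrees of the \<open>q ^ n\<close> monic polynomials of degree \<open>n\<close> add up to
  \<open>n * q ^ n\<close>, and every prime power \<open>P ^ j\<close> of degree \<open>k \<le> n\<close> contributes \<open>degree P\<close> to the degree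
  of each of its \<open>q ^ (n - k)\<close> multiples.
\<close>

lemma sum_degree_eq_sum_prime_weight:
  "n * CARD('a::{finite,field}) ^ n = (\<Sum>k=1..n. prime_weight TYPE('a) k * CARD('a) ^ (n - k))"
proof -
  let ?I = "\<Union>d\<in>{1..n}. monic_irreducibles d :: 'a poly set"
  let ?q = "CARD('a)"
  have fin: "finite ?I" by (auto simp: finite_monic_irreducibles)
  have "n * ?q ^ n = (\<Sum>f\<in>(monic_polys n :: 'a poly set). degree f)"
    by (simp add: monic_polys_def flip: card_monic_polys)
  also have "\<dots> = (\<Sum>f\<in>(monic_polys n :: 'a poly set). \<Sum>P\<in>?I. card {j \<in> {1..n}. P ^ j dvd f} * degree P)"
  proof (intro sum.cong refl)
    fix f :: "'a poly" assume f: "f \<in> monic_polys n"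
    thus "degree f = (\<Sum>P\<in>?I. card {j \<in> {1..n}. P ^ j dvd f} * degree P)"
      by (intro degree_eq_sum_exponents) (auto simp: monic_polys_def)
  qed
  also have "\<dots> = (\<Sum>P\<in>?I. degree P * (\<Sum>f\<in>monic_polys n. card {j \<in> {1..n}. P ^ j dvd f}))"
    by (subst sum.swap) (simp add: sum_distrib_left mult.commute)
  also have "\<dots> = (\<Sum>P\<in>?I. degree P * (\<Sum>j=1..n. card {f \<in> monic_polys n. P ^ j dvd f}))"
  proof (intro sum.cong refl arg_cong2[of _ _ _ _ "(*)"])
    fix P :: "'a poly"
    show "(\<Sum>f\<in>monic_polys n. card {j \<in> {1..n}. P ^ j dvd f}) =
      (\<Sum>j=1..n. card {f \<in> monic_polys n. P ^ j dvd f})"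
      by (simp only: card_filter_eq_sum finite_monic_polys finite_atLeastAtMost) (rule sum.swap)
  qed
  also have "\<dots> = (\<Sum>d=1..n. \<Sum>P\<in>(monic_irreducibles d :: 'a poly set).
      d * (\<Sum>j=1..n. if d * j \<le> n then ?q ^ (n - d * j) else 0))"
  proof -
    have "(\<Sum>P\<in>?I. degree P * (\<Sum>j=1..n. card {f \<in> monic_polys n. P ^ j dvd f})) =
      (\<Sum>d=1..n. \<Sum>P\<in>(monic_irreducibles d :: 'a poly set). degree P * (\<Sum>j=1..n. card {f \<in> monic_polys n. P ^ j dvd f}))"
      by (intro sum.UNION_disjoint)
        (auto simp: finite_monic_irreducibles, auto simp: monic_irreducibles_def monic_polys_def)
    also have "\<dots> =
      (\<Sum>d=1..n. \<Sum>P\<in>(monic_irreducibles d :: 'a poly set).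
      d * (\<Sum>j=1..n. if d * j \<le> n then ?q ^ (n - d * j) else 0))"
    proof (intro sum.cong refl arg_cong2[of _ _ _ _ "(*)"])
      fix d j and P :: "'a poly" assume P: "P \<in> monic_irreducibles d"
      thus "degree P = d" by (simp add: monic_irreducibles_def monic_polys_def)
      have "P ^ j \<in> monic_polys (d * j)"
        using P monic_polys_power[of P d j] by (simp add: monic_irreducibles_def mult.commute)
      thus "card {f \<in> monic_polys n. P ^ j dvd f} = (if d * j \<le> n then ?q ^ (n - d * j) else 0)"
        by (rule card_monic_multiples)
    qed
    finally show ?thesis .
  qed
  \<comment> \<open>Sum over the degree \<open>k = d * j\<close> of the prime power instead of the exponent \<open>j\<close>.\<close>
  also have "\<dots> = (\<Sum>d=1..n. \<Sum>k=1..n. if d dvd k then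
     d * card (monic_irreducibles d :: 'a poly set) * ?q ^ (n - k) else 0)"
  proof (intro sum.cong refl)
    fix d assume d: "d \<in> {1..n}"
    have "(\<Sum>j=1..n. if d * j \<le> n then ?q ^ (n - d * j) else 0) =
      (\<Sum>j\<in>{j\<in>{1..n}. d * j \<le> n}. ?q ^ (n - d * j))"
      by (simp add: sum.If_cases Int_def conj_commute)
    also have "\<dots> = (\<Sum>k\<in>{k\<in>{1..n}. d dvd k}. ?q ^ (n - k))"
    proof (rule sum.reindex_bij_witness[of _ "\<lambda>k. k div d" "\<lambda>j. d * j"])
      fix k assume k: "k \<in> {k \<in> {1..n}. d dvd k}"
      then obtain j where "k = d * j" by auto
      with k d show "d * (k div d) = k" "k div d \<in> {j \<in> {1..n}. d * j \<le> n}"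
        by (auto intro: order.trans[rotated] simp: Suc_le_eq)
    qed (use d in \<open>auto simp: Suc_le_eq\<close>)
    also have "\<dots> = (\<Sum>k=1..n. if d dvd k then ?q ^ (n - k) else 0)"
      by (simp add: sum.If_cases Int_def conj_commute)
    finally have "(\<Sum>P\<in>(monic_irreducibles d :: 'a poly set).
      d * (\<Sum>j=1..n. if d * j \<le> n then ?q ^ (n - d * j) else 0)) =
      d * card (monic_irreducibles d :: 'a poly set) * (\<Sum>k=1..n. if d dvd k then ?q ^ (n - k) else 0)"
      by simp
    also have "\<dots> = (\<Sum>k=1..n. if d dvd k then
       d * card (monic_irreducibles d :: 'a poly set) * ?q ^ (n - k) else 0)"
      unfolding sum_distrib_left by (intro sum.cong) auto
    finally show "(\<Sum>P\<in>(monic_irreducibles d :: 'a poly set).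
      d * (\<Sum>j=1..n. if d * j \<le> n then ?q ^ (n - d * j) else 0)) = \<dots>" .
  qed
  also have "\<dots> = (\<Sum>k=1..n. \<Sum>d=1..n. if d dvd k then
     d * card (monic_irreducibles d :: 'a poly set) * ?q ^ (n - k) else 0)"
    by (rule sum.swap)
  also have "\<dots> = (\<Sum>k=1..n. prime_weight TYPE('a) k * ?q ^ (n - k))"
  proof (intro sum.cong refl)
    fix k assume k: "k \<in> {1..n}"
    have "(\<Sum>d=1..n. if d dvd k then d * card (monic_irreducibles d :: 'a poly set) * ?q ^ (n - k) else 0) =
      (\<Sum>d\<in>{d\<in>{1..n}. d dvd k}. d * card (monic_irreducibles d :: 'a poly set) * ?q ^ (n - k))"
      by (simp add: sum.If_cases Int_def conj_commute)
    also have "{d\<in>{1..n}. d dvd k} = {d. d dvd k \<and> d \<in> {1..k}}"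
      using k by (auto dest: dvd_imp_le)
    finally show "(\<Sum>d=1..n. if d dvd k then d * card (monic_irreducibles d :: 'a poly set) * ?q ^ (n - k) else 0) =
      prime_weight TYPE('a) k * ?q ^ (n - k)"
      by (simp add: prime_weight_def sum_distrib_right)
  qed
  finally show ?thesis .
qed

text \<open>
  Subtract \<open>q\<close> times \<open>sum_degree_eq_sum_prime_weight\<close> for \<open>n - 1\<close> from the identity for \<open>n\<close>.
\<close>

theorem prime_weight_eq:
  assumes "n > 0"
  shows "prime_weight TYPE('a::{finite,field}) n = CARD('a) ^ n"
proof -
  let ?q = "CARD('a)"
  from assms obtain m where n: "n = Suc m" by (cases n) auto
  have "Suc m * ?q ^ Suc m = (\<Sum>k=1..m. prime_weight TYPE('a) k * ?q ^ (Suc m - k)) + prime_weight TYPE('a) (Suc m)"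
    by (subst sum_degree_eq_sum_prime_weight) simp
  also have "(\<Sum>k=1..m. prime_weight TYPE('a) k * ?q ^ (Suc m - k)) =
    ?q * (\<Sum>k=1..m. prime_weight TYPE('a) k * ?q ^ (m - k))"
    unfolding sum_distrib_left by (intro sum.cong refl) (simp add: Suc_diff_le)
  also have "\<dots> = ?q * (m * ?q ^ m)"
    by (simp only: sum_degree_eq_sum_prime_weight)
  finally show ?thesis by (simp add: n)
qed

text \<open>
  Let \<open>w d\<close> be the contribution of the primes of degree \<open>d\<close> to \<open>prime_weight\<close>, so \<open>w d \<le> q ^ d\<close>. In
  the identity \<open>prime_weight_eq\<close> for \<open>2 * m\<close> the proper divisors of \<open>2 * m\<close> are at most \<open>m\<close> and
  contribute at most \<open>2 * q ^ m\<close>. This is at most half of \<open>q ^ (2 * m)\<close> as soon as \<open>q ^ m \<ge> 4\<close>,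
  which \<open>m \<ge> 2\<close> guarantees for every \<open>q\<close>.
\<close>

lemma card_monic_irreducibles_even_ge:
  assumes "m \<ge> 2"
  shows "CARD('a::{finite,field}) ^ (2 * m) \<le> 4 * m * card (monic_irreducibles (2 * m) :: 'a poly set)"
proof -
  let ?q = "CARD('a)"
  define w where "w = (\<lambda>d. d * card (monic_irreducibles d :: 'a poly set))"
  have q: "?q \<ge> 2" by (rule two_le_CARD)
  have w_le: "w d \<le> ?q ^ d" if "d > 0" for d
  proof -
    have "w d \<le> prime_weight TYPE('a) d"
      unfolding prime_weight_def w_def using that
      by (intro member_le_sum) auto
    thus ?thesis using prime_weight_eq[OF that, where 'a = 'a] by simp
  qed
  have "?q ^ (2 * m) = (\<Sum>d | d dvd 2 * m \<and> d \<in> {1..2 * m}. w d)"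
    using prime_weight_eq[of "2 * m", where 'a = 'a] assms by (simp add: prime_weight_def w_def)
  also have "\<dots> \<le> (\<Sum>d\<in>insert (2 * m) {1..m}. w d)"
  proof (intro sum_mono2 subsetI)
    fix d assume "d \<in> {d. d dvd 2 * m \<and> d \<in> {1..2 * m}}"
    then obtain e where e: "2 * m = d * e" "d \<ge> 1" by auto
    show "d \<in> insert (2 * m) {1..m}"
    proof (cases "e \<le> 1")
      case True
      with e assms show ?thesis by (cases e) auto
    next
      case False
      hence "d * 2 \<le> d * e" by (intro mult_left_mono) auto
      also have "\<dots> = 2 * m" using e by simp
      finally have "d \<le> m" by linarith
      with e show ?thesis by simp
    qed
  qed auto
  also have "\<dots> = w (2 * m) + (\<Sum>d=1..m. w d)" using assms by simp
  also have "(\<Sum>d=1..m. w d) \<le> (\<Sum>d=1..m. ?q ^ d)" by (intro sum_mono w_le) auto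
  also have "\<dots> \<le> 2 * ?q ^ m"
  proof (induction m)
    case (Suc m)
    have "2 * ?q ^ m \<le> ?q ^ Suc m" using q by simp
    moreover have "(\<Sum>d=1..Suc m. ?q ^ d) = (\<Sum>d=1..m. ?q ^ d) + ?q ^ Suc m" by simp
    ultimately show ?case using Suc by linarith
  qed simp
  finally have le: "?q ^ (2 * m) \<le> w (2 * m) + 2 * ?q ^ m" by simp
  have "2 ^ 2 \<le> ?q ^ 2" using q by (intro power_mono) auto
  also have "\<dots> \<le> ?q ^ m" using q assms by (intro power_increasing) auto
  finally have "4 * ?q ^ m \<le> ?q ^ m * ?q ^ m" by (intro mult_right_mono) auto
  also have "\<dots> = ?q ^ (2 * m)" by (simp add: mult_2 power_add)
  finally show ?thesis using le by (simp add: w_def)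
qed

section \<open>Residue classes with few representations\<close>

lemma finite_cube_sols: "finite (cube_sols M a :: ('a::{finite,field} poly \<times> _) set)"
  by (rule finite_subset[of _ "polys_below (degree M) \<times> polys_below (degree M) \<times> polys_below (degree M)"])
    (auto simp: cube_sols_def finite_polys_below)

lemma mod_in_cube_sols:
  fixes M :: "'a::field poly"
  assumes "M \<noteq> 0" "M dvd N" "N dvd x ^ 3 + y ^ 3 + z ^ 3 - a" "M dvd a - b"
  shows "(x mod M, y mod M, z mod M) \<in> cube_sols M b"
proof -
  have "M dvd (x ^ 3 + y ^ 3 + z ^ 3 - a) + (a - b)"
    using assms by (intro dvd_add) (auto intro: dvd_trans)
  also have "(x ^ 3 + y ^ 3 + z ^ 3 - a) + (a - b) = x ^ 3 + y ^ 3 + z ^ 3 - b" by simp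
  finally have "(x ^ 3 + y ^ 3 + z ^ 3) mod M = b mod M"
    by (simp only: mod_eq_dvd_iff)
  also have "(x ^ 3 + y ^ 3 + z ^ 3) mod M = ((x mod M) ^ 3 + (y mod M) ^ 3 + (z mod M) ^ 3) mod M"
  proof -
    have "(u mod M) ^ 3 mod M = u ^ 3 mod M" for u by (rule power_mod)
    moreover have "(u + v + w) mod M = ((u mod M + v mod M) mod M + w mod M) mod M" for u v w
      by (simp only: mod_add_eq)
    ultimately show ?thesis by (simp only:)
  qed
  finally show ?thesis
    using assms(1) by (simp add: cube_sols_def mod_in_polys_below mod_eq_dvd_iff)
qed

text \<open>
  Half of the Chinese remainder theorem: reducing a solution modulo \<open>M\<close> and modulo \<open>P\<close> is
  injective. The class \<open>a\<close> is the one that reduces to \<open>b\<close> and \<open>c\<close>.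
\<close>

lemma card_cube_sols_mult:
  fixes M P :: "'a::{finite,field} poly"
  assumes "irreducible P" "\<not> P dvd M"
  shows "\<exists>a. card (cube_sols (M * P) a) \<le> card (cube_sols M b) * card (cube_sols P c)"
proof -
  have prime: "prime_elem P" by (rule field_poly_irreducible_imp_prime[OF assms(1)])
  have nz: "P \<noteq> 0" "M \<noteq> 0" using assms by auto
  obtain u where "M * u mod P = (c - b) mod P"
    using ex_mult_mod_eq[OF assms] by blast
  hence u: "P dvd (b + M * u) - c" by (simp add: mod_eq_dvd_iff algebra_simps)
  define a where "a = b + M * u"
  define f where "f = (\<lambda>(x, y, z). ((x mod M, y mod M, z mod M), (x mod P, y mod P, z mod P)))"
  have eq: "x = y" if "x mod M = y mod M" "x mod P = y mod P"
    "x \<in> polys_below (degree (M * P))" "y \<in> polys_below (degree (M * P))" for x y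
  proof -
    from that(1) obtain k where k: "x - y = M * k" by (auto simp: mod_eq_dvd_iff)
    have "P dvd M * k" using that(2) k by (simp add: mod_eq_dvd_iff)
    hence "P dvd k" using prime assms(2) by (simp add: prime_elem_dvd_mult_iff)
    hence "M * P dvd x - y" using k by simp
    hence "x mod (M * P) = y mod (M * P)" by (simp add: mod_eq_dvd_iff)
    thus ?thesis using that by (simp add: mod_polys_below)
  qed
  have "card (cube_sols (M * P) a) \<le> card (cube_sols M b \<times> cube_sols P c)"
  proof (rule card_le_by_inj[of _ f])
    show "inj_on f (cube_sols (M * P) a)"
    proof (rule inj_onI)
      fix s t assume "s \<in> cube_sols (M * P) a" "t \<in> cube_sols (M * P) a" and fst: "f s = f t"
      then obtain x y z x' y' z' where st: "s = (x, y, z)" "t = (x', y', z')"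
        and "x \<in> polys_below (degree (M * P))" "y \<in> polys_below (degree (M * P))"
          "z \<in> polys_below (degree (M * P))" "x' \<in> polys_below (degree (M * P))"
          "y' \<in> polys_below (degree (M * P))" "z' \<in> polys_below (degree (M * P))"
        unfolding cube_sols_def by blast
      hence "x = x'" "y = y'" "z = z'"
        using eq[of x x'] eq[of y y'] eq[of z z'] fst unfolding st f_def by simp_all
      thus "s = t" by (simp add: st)
    qed
    fix t assume "t \<in> cube_sols (M * P) a"
    then obtain x y z where t: "t = (x, y, z)" "M * P dvd x ^ 3 + y ^ 3 + z ^ 3 - a"
      by (auto simp: cube_sols_def)
    have "(x mod M, y mod M, z mod M) \<in> cube_sols M b"
      by (rule mod_in_cube_sols[OF nz(2) _ t(2)]) (auto simp: a_def)
    moreover have "(x mod P, y mod P, z mod P) \<in> cube_sols P c"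
      by (rule mod_in_cube_sols[OF nz(1) _ t(2)]) (use u in \<open>auto simp: a_def\<close>)
    ultimately show "f t \<in> cube_sols M b \<times> cube_sols P c" by (simp add: f_def t(1))
  qed (simp add: finite_cube_sols)
  thus ?thesis by (auto simp: card_cartesian_product)
qed

lemma ex_few_cube_sols_prod:
  fixes \<P> :: "'a::{finite,field} poly set"
  assumes "finite \<P>" "\<And>P. P \<in> \<P> \<Longrightarrow> P \<in> monic_irreducibles (degree P) \<and> even (degree P)"
    and "CHAR('a) \<noteq> 3"
  shows "\<exists>a. card (cube_sols (\<Prod>\<P>) a) \<le> (\<Prod>P\<in>\<P>. (CARD('a) ^ degree P - 1) ^ 2)"
  using assms(1,2)
proof (induction \<P>)
  case empty
  have "cube_sols 1 a \<subseteq> {(0, 0, 0) :: 'a poly \<times> _}" for a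
    by (auto simp: cube_sols_def polys_below_0)
  hence "card (cube_sols 1 (0 :: 'a poly)) \<le> card {(0, 0, 0) :: 'a poly \<times> 'a poly \<times> 'a poly}"
    by (intro card_mono) auto
  thus ?case by auto
next
  case (insert P \<P>)
  from insert.IH insert.prems obtain b where
    b: "card (cube_sols (\<Prod>\<P>) b) \<le> (\<Prod>P\<in>\<P>. (CARD('a) ^ degree P - 1) ^ 2)" by auto
  have P: "P \<in> monic_irreducibles (degree P)" "even (degree P)" using insert.prems by auto
  hence irr: "irreducible P" by (simp add: monic_irreducibles_def)
  obtain c where c: "card (cube_sols P c) \<le> (CARD('a) ^ degree P - 1) ^ 2"
    using ex_few_cube_sols_prime[OF irr P(2) assms(3)] by blast
  have "\<not> P dvd \<Prod>\<Q>" if "\<Q> \<subseteq> \<P>" for \<Q>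
  proof -
    from that insert.hyps(1) have "finite \<Q>" by (rule finite_subset)
    thus ?thesis using that
    proof (induction \<Q>)
      case empty
      thus ?case using irr by (simp add: irreducible_def)
    next
      case (insert Q \<Q>)
      have "Q \<noteq> P" "Q \<in> monic_irreducibles (degree Q)"
        using insert.prems \<open>P \<notin> \<P>\<close> \<open>\<And>R. R \<in> insert P \<P> \<Longrightarrow> _\<close> by auto
      hence "\<not> P dvd Q" using monic_irreducible_dvd_iff P(1) by blast
      thus ?case using insert monic_irreducible_prime[OF P(1)] by (simp add: prime_elem_dvd_mult_iff)
    qed
  qed
  from card_cube_sols_mult[OF irr this[OF subset_refl], of b c]
  obtain a where "card (cube_sols (\<Prod>\<P> * P) a) \<le> card (cube_sols (\<Prod>\<P>) b) * card (cube_sols P c)"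
    by blast
  also have "\<dots> \<le> (\<Prod>P\<in>\<P>. (CARD('a) ^ degree P - 1) ^ 2) * (CARD('a) ^ degree P - 1) ^ 2"
    by (intro mult_mono b c) auto
  finally show ?case using insert.hyps by (auto simp: mult.commute)
qed

text \<open>
  Take \<open>M\<close> to be the product of all monic primes of even degree from \<open>4\<close> to \<open>2 * D\<close>. Since
  \<open>1 - x \<le> exp (- x)\<close>, the number \<open>\<pi>\<close> of primes of absolute value \<open>Q = q ^ (2 * m)\<close> makes their joint
  factor at most \<open>exp (- 2 * \<pi> / Q) \<le> exp (- 1 / (2 * m))\<close>, and the sum of the exponents over \<open>m\<close>
  diverges with the harmonic series.
\<close>

lemma ex_small_local_density:
  assumes "CHAR('a::{finite,field}) \<noteq> 3" "\<epsilon> > 0"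
  shows "\<exists>(M :: 'a poly) a. M \<noteq> 0 \<and> real (card (cube_sols M a)) \<le> \<epsilon> * (real CARD('a) ^ degree M) ^ 2"
proof -
  let ?q = "CARD('a)"
  have q: "?q \<ge> 2" by (rule two_le_CARD)
  have "filterlim (harm :: nat \<Rightarrow> real) at_top sequentially" by (rule harm_at_top)
  hence "eventually (\<lambda>D. harm D \<ge> 1 - 2 * ln \<epsilon>) sequentially" by (auto simp: filterlim_at_top)
  then obtain D where D: "harm D \<ge> 1 - 2 * ln \<epsilon>" "D \<ge> 1"
    by (metis (mono_tags, lifting) eventually_sequentially linear)
  define \<P> where "\<P> = (\<Union>m\<in>{2..D}. monic_irreducibles (2 * m) :: 'a poly set)"
  have fin: "finite \<P>" by (simp add: \<P>_def finite_monic_irreducibles)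
  have mem: "P \<in> monic_irreducibles (degree P) \<and> even (degree P)" if "P \<in> \<P>" for P
    using that by (auto simp: \<P>_def monic_irreducibles_def monic_polys_def)
  have "0 \<notin> \<P>" using mem[of 0] by (auto simp: monic_irreducibles_def)
  hence nz: "\<Prod>\<P> \<noteq> 0" using fin by auto
  obtain a where a: "card (cube_sols (\<Prod>\<P>) a) \<le> (\<Prod>P\<in>\<P>. (?q ^ degree P - 1) ^ 2)"
    using ex_few_cube_sols_prod[OF fin mem assms(1)] by blast
  have deg: "real ?q ^ degree (\<Prod>\<P>) = (\<Prod>P\<in>\<P>. real ?q ^ degree P)"
  proof -
    have "degree (\<Prod>\<P>) = (\<Sum>P\<in>\<P>. degree P)"
      using degree_prod_eq_sum_degree[of \<P> "\<lambda>P. P"] \<open>0 \<notin> \<P>\<close> by fastforce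
    thus ?thesis by (simp add: power_sum)
  qed
  have "real (card (cube_sols (\<Prod>\<P>) a)) \<le> real (\<Prod>P\<in>\<P>. (?q ^ degree P - 1) ^ 2)"
    using a by (simp only: of_nat_le_iff)
  also have "\<dots> = (\<Prod>P\<in>\<P>. (real ?q ^ degree P) ^ 2 * (1 - 1 / real ?q ^ degree P) ^ 2)"
  proof (simp only: of_nat_prod, intro prod.cong refl)
    fix P
    have "1 \<le> ?q ^ degree P" using q by simp
    hence "real ((?q ^ degree P - 1) ^ 2) = (real ?q ^ degree P - 1) ^ 2"
      by (simp add: of_nat_diff)
    also have "real ?q ^ degree P - 1 = real ?q ^ degree P * (1 - 1 / real ?q ^ degree P)"
      using q by (simp add: field_simps)
    finally show "real ((?q ^ degree P - 1) ^ 2) = (real ?q ^ degree P) ^ 2 * (1 - 1 / real ?q ^ degree P) ^ 2"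
      by (simp only: power_mult_distrib)
  qed
  also have "\<dots> = (real ?q ^ degree (\<Prod>\<P>)) ^ 2 * (\<Prod>P\<in>\<P>. (1 - 1 / real ?q ^ degree P) ^ 2)"
    by (simp only: deg prod.distrib prod_power_distrib)
  also have "(\<Prod>P\<in>\<P>. (1 - 1 / real ?q ^ degree P) ^ 2) \<le> \<epsilon>"
  proof -
    have "(\<Prod>P\<in>\<P>. (1 - 1 / real ?q ^ degree P) ^ 2) =
      (\<Prod>m=2..D. \<Prod>P\<in>(monic_irreducibles (2 * m) :: 'a poly set). (1 - 1 / real ?q ^ degree P) ^ 2)"
      unfolding \<P>_def by (intro prod.UNION_disjoint)
        (auto simp: finite_monic_irreducibles, auto simp: monic_irreducibles_def monic_polys_def)
    also have "\<dots> \<le> (\<Prod>m=2..D. exp (- (1 / (2 * real m))))"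
    proof (intro prod_mono conjI prod_nonneg)
      fix m assume m: "m \<in> {2..D}"
      define \<pi> where "\<pi> = card (monic_irreducibles (2 * m) :: 'a poly set)"
      define Q where "Q = real ?q ^ (2 * m)"
      have Q: "Q \<ge> 1" using q by (simp add: Q_def)
      have "real (?q ^ (2 * m)) \<le> real (4 * m * \<pi>)"
        using card_monic_irreducibles_even_ge[of m, where 'a = 'a] m
        unfolding \<pi>_def by (simp only: of_nat_le_iff atLeastAtMost_iff)
      hence "Q \<le> 4 * real m * real \<pi>" by (simp add: Q_def)
      hence le: "1 / (2 * real m) \<le> 2 * real \<pi> / Q"
        using Q m by (simp add: field_simps)
      have "(\<Prod>P\<in>(monic_irreducibles (2 * m) :: 'a poly set). (1 - 1 / real ?q ^ degree P) ^ 2) =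
        (\<Prod>P\<in>(monic_irreducibles (2 * m) :: 'a poly set). (1 - 1 / Q) ^ 2)"
        by (intro prod.cong) (auto simp: monic_irreducibles_def monic_polys_def Q_def)
      also have "\<dots> = (1 - 1 / Q) ^ (2 * \<pi>)" by (simp add: \<pi>_def power_mult)
      also have "\<dots> \<le> exp (- (1 / Q)) ^ (2 * \<pi>)"
        using Q exp_ge_add_one_self[of "- (1 / Q)"] by (intro power_mono) auto
      also have "\<dots> = exp (- (2 * real \<pi> / Q))"
        by (simp flip: exp_of_nat_mult)
      also have "\<dots> \<le> exp (- (1 / (2 * real m)))" using le by simp
      finally show "(\<Prod>P\<in>(monic_irreducibles (2 * m) :: 'a poly set). (1 - 1 / real ?q ^ degree P) ^ 2)
        \<le> exp (- (1 / (2 * real m)))" .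
    qed auto
    also have "\<dots> = exp (\<Sum>m=2..D. - (1 / (2 * real m)))" by (simp add: exp_sum)
    also have "(\<Sum>m=2..D. - (1 / (2 * real m))) = - (harm D - 1) / 2"
    proof -
      have "harm D = (1::real) + (\<Sum>m=2..D. 1 / real m)"
        unfolding harm_def using D(2) by (subst sum.atLeast_Suc_atMost) (auto simp: numeral_2_eq_2 inverse_eq_divide)
      thus ?thesis by (simp add: sum_negf sum_divide_distrib mult.commute)
    qed
    also have "exp (- (harm D - 1) / 2) \<le> exp (ln \<epsilon>)" using D(1) by simp
    finally show ?thesis using assms(2) by simp
  qed
  finally have "real (card (cube_sols (\<Prod>\<P>) a)) \<le> \<epsilon> * (real ?q ^ degree (\<Prod>\<P>)) ^ 2"
    by (simp add: mult.commute mult_left_mono)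
  with nz show ?thesis by blast
qed

section \<open>Boxes and densities\<close>

lemma div_in_polys_below:
  fixes M :: "'a::field poly"
  assumes "p \<in> polys_below m" "M \<noteq> 0"
  shows "p div M \<in> polys_below (m - degree M)"
proof (cases "p div M = 0")
  case False
  have "degree (p div M * M) = degree (p div M) + degree M"
    using False assms by (simp add: degree_mult_eq)
  moreover have "p mod M = 0 \<or> degree (p mod M) < degree M" using assms by (intro degree_mod_less)
  ultimately have "degree (p div M * M + p mod M) = degree (p div M) + degree M"
    using degree_add_eq_left[of "p mod M" "p div M * M"] by (elim disjE) simp_all
  hence "degree p = degree (p div M) + degree M" by simp
  moreover have "p \<noteq> 0" using False by auto
  ultimately show ?thesis using assms(1) by (auto simp: polys_below_iff)
qed (simp add: polys_below_iff)

text \<open>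
  Division with remainder by \<open>M\<close> maps the triples injectively to a solution modulo \<open>M\<close>, given by
  the remainders, together with three quotients of degree less than \<open>m - degree M\<close>.
\<close>

lemma card_box_cube_sols:
  fixes M :: "'a::{finite,field} poly"
  assumes "M \<noteq> 0"
  shows "card {(x, y, z). x \<in> polys_below m \<and> y \<in> polys_below m \<and> z \<in> polys_below m \<and>
      M dvd x ^ 3 + y ^ 3 + z ^ 3 - a} \<le> card (cube_sols M a) * (CARD('a) ^ (m - degree M)) ^ 3"
proof -
  let ?B = "polys_below (m - degree M) :: 'a poly set"
  let ?X = "{(x, y, z). x \<in> polys_below m \<and> y \<in> polys_below m \<and> z \<in> polys_below m \<and>
      M dvd x ^ 3 + y ^ 3 + z ^ 3 - a}"
  define f where "f = (\<lambda>(x, y, z). ((x mod M, y mod M, z mod M), (x div M, y div M, z div M)))"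
  have eq: "x = y" if "x mod M = y mod M" "x div M = y div M" for x y
  proof -
    have "x div M * M + x mod M = y div M * M + y mod M" using that by (simp only:)
    thus ?thesis by (simp only: div_mult_mod_eq)
  qed
  have "card ?X \<le> card (cube_sols M a \<times> (?B \<times> ?B \<times> ?B))"
  proof (rule card_le_by_inj[of _ f])
    show "inj_on f ?X"
    proof (rule inj_onI)
      fix s t assume fst: "f s = f t"
      obtain x y z x' y' z' where st: "s = (x, y, z)" "t = (x', y', z')" by (cases s, cases t)
      have "x = x'" "y = y'" "z = z'"
        using eq[of x x'] eq[of y y'] eq[of z z'] fst unfolding st f_def by simp_all
      thus "s = t" by (simp add: st)
    qed
    fix t assume "t \<in> ?X"
    then obtain x y z where t: "t = (x, y, z)" "x \<in> polys_below m" "y \<in> polys_below m"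
      "z \<in> polys_below m" "M dvd x ^ 3 + y ^ 3 + z ^ 3 - a" by auto
    have "(x mod M, y mod M, z mod M) \<in> cube_sols M a"
      by (rule mod_in_cube_sols[OF assms _ t(5)]) auto
    thus "f t \<in> cube_sols M a \<times> (?B \<times> ?B \<times> ?B)"
      using t div_in_polys_below[OF _ assms] by (simp add: f_def)
  qed (simp add: finite_cube_sols finite_polys_below)
  also have "\<dots> = card (cube_sols M a) * (CARD('a) ^ (m - degree M)) ^ 3"
    by (simp add: card_cartesian_product card_polys_below power3_eq_cube)
  finally show ?thesis .
qed

lemma card_residue_class_ge:
  fixes M :: "'a::{finite,field} poly"
  assumes "M \<noteq> 0" "degree M \<le> T"
  shows "CARD('a) ^ (T - degree M) \<le> card {k \<in> polys_below T. M dvd k - a}"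
proof -
  have "card (polys_below (T - degree M) :: 'a poly set) \<le> card {k \<in> polys_below T. M dvd k - a}"
  proof (rule card_le_by_inj[of _ "\<lambda>p. M * p + a mod M"])
    fix p :: "'a poly" assume p: "p \<in> polys_below (T - degree M)"
    have "M * p \<in> polys_below T"
      using p assms by (cases "p = 0") (auto simp: polys_below_iff degree_mult_eq)
    moreover have "a mod M \<in> polys_below T"
      using degree_mod_less[OF assms(1), of a] assms by (auto simp: polys_below_iff)
    moreover have "M dvd M * p + a mod M - a"
      by (simp add: mod_eq_dvd_iff[symmetric])
    ultimately show "M * p + a mod M \<in> {k \<in> polys_below T. M dvd k - a}"
      by (simp add: polys_below_arith)
  qed (use assms in \<open>auto simp: inj_on_def finite_polys_below\<close>)
  thus ?thesis by (simp add: card_polys_below)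
qed

text \<open>
  For \<open>k = 0\<close> the defining condition of \<open>S\<close> forces \<open>x = y = z = 0\<close>, which lies in every box; for
  other \<open>k\<close> the degrees are at most \<open>T / 3 + A\<close>, since \<open>degree k < T\<close>.
\<close>

lemma in_S_imp_small_representation:
  fixes k :: "'a::{finite,field} poly"
  assumes "k \<in> S A" "pabs k < real CARD('a) ^ T" "real T / 3 + A < real m"
  shows "k \<in> polys_below T"
    and "\<exists>x\<in>polys_below m. \<exists>y\<in>polys_below m. \<exists>z\<in>polys_below m. k = x ^ 3 + y ^ 3 + z ^ 3"
proof -
  have q: "CARD('a) \<ge> 2" by (rule two_le_CARD)
  show kT: "k \<in> polys_below T"
  proof (cases "k = 0")
    case False
    hence "real CARD('a) ^ degree k < real CARD('a) ^ T" using assms(2) by (simp add: pabs_def)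
    hence "degree k < T" using q by (subst (asm) power_strict_increasing_iff) auto
    thus ?thesis by (simp add: polys_below_iff)
  qed (simp add: polys_below_iff)
  have small: "x \<in> polys_below m" if "pdeg x \<le> pdeg k / 3 + ereal A" for x :: "'a poly"
  proof (cases "x = 0")
    case False
    have "k \<noteq> 0" using that False by (auto simp: pdeg_def)
    hence "real (degree x) \<le> real (degree k) / 3 + A"
      using that False by (simp add: pdeg_def)
    moreover have "degree k < T" using kT \<open>k \<noteq> 0\<close> by (simp add: polys_below_iff)
    ultimately have "real (degree x) < real m" using assms(3) by simp
    thus ?thesis by (simp add: polys_below_iff)
  qed (simp add: polys_below_iff)
  from assms(1) obtain x y z where "x ^ 3 + y ^ 3 + z ^ 3 = k"
    "Max {pdeg x, pdeg y, pdeg z} \<le> pdeg k / 3 + ereal A"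
    unfolding S_def by auto
  moreover from this have "pdeg x \<le> pdeg k / 3 + ereal A" "pdeg y \<le> pdeg k / 3 + ereal A"
    "pdeg z \<le> pdeg k / 3 + ereal A" by simp_all
  ultimately show "\<exists>x\<in>polys_below m. \<exists>y\<in>polys_below m. \<exists>z\<in>polys_below m. k = x ^ 3 + y ^ 3 + z ^ 3"
    using small by blast
qed

theorem theorem1p2:
  fixes A :: real
  assumes "CHAR('a::{finite,field}) \<noteq> 3"
  shows "upper_density (S A :: 'a poly set) < 1"
proof -
  let ?q = "real CARD('a)"
  have "CARD('a) \<ge> 2" by (rule two_le_CARD)
  hence q: "?q \<ge> 2" by simp
  define C where "C = ?q powr (3 * A + 3)"
  have C: "C > 0" using q by (simp add: C_def)
  obtain M a where M: "(M :: 'a poly) \<noteq> 0"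
    and dens: "real (card (cube_sols M a)) \<le> 1 / (2 * C) * (?q ^ degree M) ^ 2"
    using ex_small_local_density[OF assms, of "1 / (2 * C)"] C by auto
  define d where "d = degree M"
  let ?f = "\<lambda>T. real (card {k \<in> (S A :: 'a poly set). pabs k < ?q ^ T}) / ?q ^ T"
  \<comment> \<open>beyond \<open>T0\<close>, both \<open>T\<close> and \<open>T / 3 + A\<close> are at least \<open>d\<close>\<close>
  define T0 where "T0 = nat \<lceil>3 * (real d + \<bar>A\<bar>)\<rceil>"
  have bound: "?f T \<le> 1 - 1 / (2 * ?q ^ d)" if T: "T \<ge> T0" for T
  proof -
    have "3 * (real d + \<bar>A\<bar>) \<le> real T" using T unfolding T0_def by linarith
    moreover have "- A \<le> \<bar>A\<bar>" "0 \<le> \<bar>A\<bar>" by simp_all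
    ultimately have T': "3 * real d - 3 * A \<le> real T" "3 * real d \<le> real T" by argo+
    \<comment> \<open>the number of coefficients of a polynomial of degree at most \<open>T / 3 + A\<close>\<close>
    define m where "m = nat (\<lfloor>real T / 3 + A\<rfloor> + 1)"
    have x: "real T / 3 + A \<ge> real d" using T' by argo
    have m: "real T / 3 + A < real m" "real m \<le> real T / 3 + A + 1"
      unfolding m_def using x by linarith+
    have dm: "d \<le> m" using m x by linarith
    have dT: "d \<le> T" using T' by linarith
    define B where "B = {(x, y, z). x \<in> polys_below m \<and> y \<in> polys_below m \<and> z \<in> polys_below m \<and>
      M dvd x ^ 3 + y ^ 3 + z ^ 3 - a}"
    let ?W = "{k \<in> S A. pabs k < ?q ^ T} :: 'a poly set"
    let ?R = "{k \<in> polys_below T. M dvd k - a}"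
    have finB: "finite B"
      by (rule finite_subset[of _ "polys_below m \<times> polys_below m \<times> polys_below m"])
        (auto simp: B_def finite_polys_below)
    have "?W \<subseteq> (polys_below T - ?R) \<union> (\<lambda>(x, y, z). x ^ 3 + y ^ 3 + z ^ 3) ` B"
    proof
      fix k assume k: "k \<in> ?W"
      obtain x y z where xyz: "x \<in> polys_below m" "y \<in> polys_below m" "z \<in> polys_below m"
        "k = x ^ 3 + y ^ 3 + z ^ 3"
        using in_S_imp_small_representation(2)[of k A T m] k m by auto
      have "k \<in> polys_below T" using in_S_imp_small_representation(1)[of k A T m] k m by auto
      moreover have "k \<in> (\<lambda>(x, y, z). x ^ 3 + y ^ 3 + z ^ 3) ` B" if "M dvd k - a"
        using xyz that by (intro image_eqI[of _ _ "(x, y, z)"]) (auto simp: B_def)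
      ultimately show "k \<in> (polys_below T - ?R) \<union> (\<lambda>(x, y, z). x ^ 3 + y ^ 3 + z ^ 3) ` B" by blast
    qed
    hence "card ?W \<le> card ((polys_below T - ?R) \<union> (\<lambda>(x, y, z). x ^ 3 + y ^ 3 + z ^ 3) ` B)"
      using finB by (intro card_mono) (auto simp: finite_polys_below)
    also have "\<dots> \<le> card (polys_below T - ?R) + card B"
      using card_Un_le card_image_le[OF finB] by (meson add_left_mono order.trans)
    finally have "card ?W \<le> card (polys_below T - ?R) + card B" .
    moreover have "card (polys_below T - ?R) = CARD('a) ^ T - card ?R"
      by (subst card_Diff_subset) (auto simp: finite_polys_below card_polys_below)
    moreover have "CARD('a) ^ (T - d) \<le> card ?R"
      using card_residue_class_ge[OF M, of T a] dT by (simp add: d_def)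
    moreover have "card ?R \<le> CARD('a) ^ T"
      unfolding card_polys_below[symmetric] by (intro card_mono) (auto simp: finite_polys_below)
    ultimately have "real (card ?W) \<le> real (CARD('a) ^ T) - real (CARD('a) ^ (T - d)) + real (card B)"
      by linarith
    also have "real (CARD('a) ^ (T - d)) = ?q ^ T / ?q ^ d"
      unfolding of_nat_power by (rule power_diff) (use dT q in auto)
    also have "real (card B) \<le> ?q ^ T / (2 * ?q ^ d)"
    proof -
      have "real (card B) \<le> real (card (cube_sols M a) * (CARD('a) ^ (m - d)) ^ 3)"
        using card_box_cube_sols[OF M, of m a] unfolding B_def d_def by (simp only: of_nat_le_iff)
      also have "\<dots> = real (card (cube_sols M a)) * (?q ^ m / ?q ^ d) ^ 3"
        unfolding of_nat_mult of_nat_power by (subst power_diff) (use dm q in auto)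
      also have "\<dots> \<le> 1 / (2 * C) * (?q ^ d) ^ 2 * (?q ^ m / ?q ^ d) ^ 3"
        using dens q by (intro mult_right_mono) (auto simp: d_def)
      also have "\<dots> = 1 / (2 * C) * (?q ^ m) ^ 3 / ?q ^ d"
        using q by (simp add: power2_eq_square power3_eq_cube field_simps)
      also have "(?q ^ m) ^ 3 = ?q powr (3 * real m)"
        using q by (simp add: powr_realpow[symmetric] powr_powr mult.commute flip: power_mult)
      also have "\<dots> \<le> ?q powr (real T + (3 * A + 3))"
        using q m by (intro powr_mono) auto
      also have "\<dots> = ?q ^ T * C"
        using q by (simp add: C_def powr_add powr_realpow)
      finally show ?thesis using C q by (simp add: field_simps)
    qed
    finally have "real (card ?W) \<le> ?q ^ T * (1 - 1 / (2 * ?q ^ d))"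
      by (simp add: field_simps)
    thus ?thesis using q by (simp add: divide_le_eq mult.commute)
  qed
  have "upper_density (S A :: 'a poly set) \<le> ereal (1 - 1 / (2 * ?q ^ d))"
    unfolding upper_density_def
    by (rule Limsup_bounded) (use bound in \<open>auto simp: eventually_sequentially intro!: exI[of _ T0]\<close>)
  also have "\<dots> < 1" using q by simp
  finally show ?thesis .
qed

end
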